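(* Let $G$ be a finitely generated group, let $\sigma,\tau$ be endomorphisms of $G$, and suppose that $G$ is a $(\sigma,\tau)$-$FC$ group. Then there is an isomorphism of complex vector spaces $$\mathcal{D}_{(\sigma,\tau)}(\mathbb{C}[G])\;\cong\;\Bigl(\bigoplus_{[a]_{(\sigma,\tau)}} Z^*_{(\sigma,\tau)}(a)\Bigr)\;\oplus\;Inn(\Gamma),$$ where the direct sum is over all $(\sigma,\tau)$-conjugacy classes $[a]_{(\sigma,\tau)}$ in $G$ (one representative $a$ for each class), $Z^*_{(\sigma,\tau)}(a)=\operatorname{Hom}(Z_{(\sigma,\tau)}(a),\mathbb{C})$ is the space of group homomorphisms from the $(\sigma,\tau)$-centralizer of $a$ to the additive group of $\mathbb{C}$, and $Inn(\Gamma)$ is the space of inner $(\sigma,\tau)$-derivations of $\mathbb{C}[G]$.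
   Context: The endomorphisms $\sigma,\tau$ are extended linearly to $\mathbb{C}[G]$. A $(\sigma,\tau)$-derivation is a $\mathbb{C}$-linear map $D:\mathbb{C}[G]\to\mathbb{C}[G]$ with $D(ab)=D(a)\tau(b)+\sigma(a)D(b)$; $\mathcal{D}_{(\sigma,\tau)}(\mathbb{C}[G])$ is the vector space of all of them. For $p\in\mathbb{C}[G]$ the map $\delta_p(x)=p\tau(x)-\sigma(x)p$ is a $(\sigma,\tau)$-derivation; those of this form are called inner. $(\sigma,\tau)$-conjugacy class of $a\in G$: $[a]_{(\sigma,\tau)}=\{\sigma(v)a\tau(v^{-1}) : v\in G\}$. $(\sigma,\tau)$-centralizer of $a$: $Z_{(\sigma,\tau)}(a)=\{z\in G : \sigma(z)a=a\tau(z)\}$. $G$ is a $(\sigma,\tau)$-$FC$ group if every $(\sigma,\tau)$-conjugacy class is finite. *)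

theory Defs
  imports
    Complex_Main
    "HOL-Library.Poly_Mapping"
    "HOL-Algebra.Generated_Groups"
    "HOL-Algebra.Module"
    "HOL-Algebra.Chinese_Remainder"
    "HOL-Algebra.Algebraic_Closure_Type"
begin

section \<open>Modules\<close>

text \<open>
  Maps between carriers are extensional (undefined outside the domain), so that
  two maps agreeing on the carrier are equal. The record of a module also has the
  fields \<open>mult\<close> and \<open>one\<close>; modules never use them, and for the spaces of maps below they
  carry no meaning.
\<close>

definition linear_maps ::
    "('r, 'k) ring_scheme \<Rightarrow> ('r, 'a, 'm) module_scheme \<Rightarrow> ('r, 'b, 'n) module_scheme \<Rightarrow> ('a \<Rightarrow> 'b) set"
  where "linear_maps R M N =
    {f \<in> carrier M \<rightarrow>\<^sub>E carrier N.
       (\<forall>x\<in>carrier M. \<forall>y\<in>carrier M. f (x \<oplus>\<^bsub>M\<^esub> y) = f x \<oplus>\<^bsub>N\<^esub> f y) \<and>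
       (\<forall>c\<in>carrier R. \<forall>x\<in>carrier M. f (c \<odot>\<^bsub>M\<^esub> x) = c \<odot>\<^bsub>N\<^esub> f x)}"

definition module_isomorphic ::
    "('r, 'k) ring_scheme \<Rightarrow> ('r, 'a, 'm) module_scheme \<Rightarrow> ('r, 'b, 'n) module_scheme \<Rightarrow> bool"
  where "module_isomorphic R M N \<longleftrightarrow>
    (\<exists>f \<in> linear_maps R M N. bij_betw f (carrier M) (carrier N))"

definition module_product :: "'i set \<Rightarrow> ('i \<Rightarrow> ('r, 'a, 'm) module_scheme) \<Rightarrow> ('r, 'i \<Rightarrow> 'a) module"
  where "module_product I M =
    \<lparr>carrier = (\<Pi>\<^sub>E i\<in>I. carrier (M i)),
     monoid.mult = (\<lambda>f g. \<lambda>i\<in>I. f i \<otimes>\<^bsub>M i\<^esub> g i),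
     one = (\<lambda>i\<in>I. \<one>\<^bsub>M i\<^esub>),
     ring.zero = (\<lambda>i\<in>I. \<zero>\<^bsub>M i\<^esub>),
     add = (\<lambda>f g. \<lambda>i\<in>I. f i \<oplus>\<^bsub>M i\<^esub> g i),
     module.smult = (\<lambda>c f. \<lambda>i\<in>I. c \<odot>\<^bsub>M i\<^esub> f i)\<rparr>"

definition module_direct_sum :: "'i set \<Rightarrow> ('i \<Rightarrow> ('r, 'a, 'm) module_scheme) \<Rightarrow> ('r, 'i \<Rightarrow> 'a) module"
  where "module_direct_sum I M = (module_product I M)
    \<lparr>carrier := {f \<in> \<Pi>\<^sub>E i\<in>I. carrier (M i). finite {i \<in> I. f i \<noteq> \<zero>\<^bsub>M i\<^esub>}}\<rparr>"

definition module_DirProd ::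
    "('r, 'a, 'm) module_scheme \<Rightarrow> ('r, 'b, 'n) module_scheme \<Rightarrow> ('r, 'a \<times> 'b) module"
  where "module_DirProd M N =
    ring.extend (RDirProd M N) \<lparr>module.smult = (\<lambda>c (x, y). (c \<odot>\<^bsub>M\<^esub> x, c \<odot>\<^bsub>N\<^esub> y))\<rparr>"

lemma carrier_module_DirProd [simp]: "carrier (module_DirProd M N) = carrier M \<times> carrier N"
  and zero_module_DirProd [simp]: "\<zero>\<^bsub>module_DirProd M N\<^esub> = (\<zero>\<^bsub>M\<^esub>, \<zero>\<^bsub>N\<^esub>)"
  and add_module_DirProd [simp]:
    "x \<oplus>\<^bsub>module_DirProd M N\<^esub> y = (fst x \<oplus>\<^bsub>M\<^esub> fst y, snd x \<oplus>\<^bsub>N\<^esub> snd y)"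
  and smult_module_DirProd [simp]:
    "c \<odot>\<^bsub>module_DirProd M N\<^esub> x = (c \<odot>\<^bsub>M\<^esub> fst x, c \<odot>\<^bsub>N\<^esub> snd x)"
  by (simp_all add: module_DirProd_def RDirProd_def DirProd_def ring.defs monoid.defs
        case_prod_unfold)

lemma module_product_simps [simp]:
  "carrier (module_product I M) = (\<Pi>\<^sub>E i\<in>I. carrier (M i))"
  "\<zero>\<^bsub>module_product I M\<^esub> = (\<lambda>i\<in>I. \<zero>\<^bsub>M i\<^esub>)"
  "f \<oplus>\<^bsub>module_product I M\<^esub> g = (\<lambda>i\<in>I. f i \<oplus>\<^bsub>M i\<^esub> g i)"
  "c \<odot>\<^bsub>module_product I M\<^esub> f = (\<lambda>i\<in>I. c \<odot>\<^bsub>M i\<^esub> f i)"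
  by (simp_all add: module_product_def)

lemma module_module_product:
  assumes "cring R" and "\<And>i. i \<in> I \<Longrightarrow> module R (M i)"
  shows "module R (module_product I M)"
proof (rule moduleI)
  have ab: "abelian_group (M i)" if "i \<in> I" for i
    using assms(2)[OF that] by (simp add: module_def)
  note [simp] = abelian_monoid.a_closed[OF abelian_group.axioms(1)[OF ab]] abelian_group.a_inv_closed[OF ab]
    abelian_monoid.zero_closed[OF abelian_group.axioms(1)[OF ab]]
    abelian_monoid.a_assoc[OF abelian_group.axioms(1)[OF ab]]
    abelian_monoid.l_zero[OF abelian_group.axioms(1)[OF ab]]
    abelian_group.l_neg[OF ab] module.smult_closed[OF assms(2)]
    module.smult_one[OF assms(2)]
  show "abelian_group (module_product I M)"
  proof (rule abelian_groupI)
    fix f assume f: "f \<in> carrier (module_product I M)"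
    show "\<exists>g\<in>carrier (module_product I M). g \<oplus>\<^bsub>module_product I M\<^esub> f = \<zero>\<^bsub>module_product I M\<^esub>"
      using f by (intro bexI[of _ "\<lambda>i\<in>I. \<ominus>\<^bsub>M i\<^esub> f i"]) (auto simp: PiE_iff)
    show "\<zero>\<^bsub>module_product I M\<^esub> \<oplus>\<^bsub>module_product I M\<^esub> f = f"
      using f by (auto simp: PiE_iff extensional_def)
    fix g assume g: "g \<in> carrier (module_product I M)"
    show "f \<oplus>\<^bsub>module_product I M\<^esub> g = g \<oplus>\<^bsub>module_product I M\<^esub> f"
      using f g by (auto simp: PiE_iff abelian_monoid.a_comm[OF abelian_group.axioms(1)[OF ab]])
  qed (auto simp: PiE_iff)
qed (use assms(1) in \<open>auto simp: PiE_iff Module.module.smult_closed[OF assms(2)]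
       Module.module.smult_l_distr[OF assms(2)] Module.module.smult_r_distr[OF assms(2)]
       Module.module.smult_assoc1[OF assms(2)] Module.module.smult_one[OF assms(2)]
       extensional_def intro!: restrict_ext\<close>)

lemma module_product_a_inv:
  assumes "cring R" and M: "\<And>i. i \<in> I \<Longrightarrow> module R (M i)" and f: "f \<in> carrier (module_product I M)"
  shows "\<ominus>\<^bsub>module_product I M\<^esub> f = (\<lambda>i\<in>I. \<ominus>\<^bsub>M i\<^esub> f i)"
proof -
  interpret module R "module_product I M"
    using assms by (intro module_module_product)
  have ab: "abelian_group (M i)" if "i \<in> I" for i
    using M[OF that] by (simp add: module_def)
  show ?thesis
    using f by (intro M.minus_equality)
      (auto simp: PiE_iff abelian_group.a_inv_closed[OF ab] abelian_group.l_neg[OF ab])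
qed

lemma module_module_direct_sum:
  assumes "cring R" and M: "\<And>i. i \<in> I \<Longrightarrow> module R (M i)"
  shows "module R (module_direct_sum I M)"
proof -
  interpret P: module R "module_product I M"
    using assms by (intro module_module_product)
  have ab: "abelian_group (M i)" if "i \<in> I" for i
    using M[OF that] by (simp add: module_def)
  note [simp] = abelian_monoid.a_closed[OF abelian_group.axioms(1)[OF ab]] abelian_group.a_inv_closed[OF ab]
    abelian_monoid.zero_closed[OF abelian_group.axioms(1)[OF ab]]
    abelian_monoid.l_zero[OF abelian_group.axioms(1)[OF ab]]
    module.smult_closed[OF M] module.smult_r_null[OF M]
  have [simp]: "\<ominus>\<^bsub>M i\<^esub> \<zero>\<^bsub>M i\<^esub> = \<zero>\<^bsub>M i\<^esub>" if "i \<in> I" for i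
    using that by (intro abelian_group.minus_equality[OF ab]) auto
  let ?H = "{f \<in> \<Pi>\<^sub>E i\<in>I. carrier (M i). finite {i \<in> I. f i \<noteq> \<zero>\<^bsub>M i\<^esub>}}"
  have "submodule ?H R (module_product I M)"
  proof (rule P.submoduleI)
    show "\<zero>\<^bsub>module_product I M\<^esub> \<in> ?H"
      by (auto cong: conj_cong)
    show "\<ominus>\<^bsub>module_product I M\<^esub> f \<in> ?H" if f: "f \<in> ?H" for f
      using f
      by (auto simp: module_product_a_inv[OF assms] PiE_iff
            elim!: rev_finite_subset)
    show "f \<oplus>\<^bsub>module_product I M\<^esub> g \<in> ?H" if f: "f \<in> ?H" and g: "g \<in> ?H" for f g
    proof -
      have "finite ({i \<in> I. f i \<noteq> \<zero>\<^bsub>M i\<^esub>} \<union> {i \<in> I. g i \<noteq> \<zero>\<^bsub>M i\<^esub>})"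
        using f g by simp
      then have "finite {i \<in> I. (\<lambda>i\<in>I. f i \<oplus>\<^bsub>M i\<^esub> g i) i \<noteq> \<zero>\<^bsub>M i\<^esub>}"
        by (rule rev_finite_subset) (use f g in auto)
      then show ?thesis
        using f g by (auto simp: PiE_iff)
    qed
    show "c \<odot>\<^bsub>module_product I M\<^esub> f \<in> ?H" if "c \<in> carrier R" and f: "f \<in> ?H" for c f
      using that by (auto simp: PiE_iff elim!: rev_finite_subset)
  qed auto
  from submodule.submodule_is_module[OF this P.module_axioms] show ?thesis
    by (simp add: module_direct_sum_def)
qed

lemma module_module_DirProd:
  assumes "module R M" and "module R N"
  shows "module R (module_DirProd M N)"
proof -
  interpret M: module R M by fact
  interpret N: module R N by fact
  show ?thesis
  proof (rule moduleI)
    show "abelian_group (module_DirProd M N)"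
    proof (rule abelian_groupI)
      fix x assume "x \<in> carrier (module_DirProd M N)"
      then show "\<exists>y\<in>carrier (module_DirProd M N). y \<oplus>\<^bsub>module_DirProd M N\<^esub> x = \<zero>\<^bsub>module_DirProd M N\<^esub>"
        by (intro bexI[of _ "(\<ominus>\<^bsub>M\<^esub> fst x, \<ominus>\<^bsub>N\<^esub> snd x)"]) (auto simp: M.M.l_neg N.M.l_neg)
    qed (auto simp: M.M.a_assoc N.M.a_assoc intro: M.M.a_comm N.M.a_comm)
  qed (auto simp: M.R.is_cring M.smult_l_distr N.smult_l_distr M.smult_r_distr N.smult_r_distr
         M.smult_assoc1 N.smult_assoc1)
qed


section \<open>The complex group algebra\<close>

abbreviation complex_field :: "complex ring"
  where "complex_field \<equiv> ring_of_type_algebra"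

definition complex_line :: "(complex, complex) module"
  where "complex_line = ring.extend complex_field \<lparr>module.smult = (*)\<rparr>"

text \<open>
  Elements of the group algebra are finitely supported functions, supported in the carrier
  of the group; \<open>Poly_Mapping.single x c\<close> is the element $c \cdot x$. The product of
  type \<open>poly_mapping\<close> is not used because it takes its group structure from a type class.
\<close>

definition group_algebra :: "('g, 'm) monoid_scheme \<Rightarrow> (complex, 'g \<Rightarrow>\<^sub>0 complex) module"
  where "group_algebra G =
    \<lparr>carrier = {p. Poly_Mapping.keys p \<subseteq> carrier G},
     monoid.mult = (\<lambda>p q. \<Sum>x\<in>Poly_Mapping.keys p. \<Sum>y\<in>Poly_Mapping.keys q.
       Poly_Mapping.single (x \<otimes>\<^bsub>G\<^esub> y) (Poly_Mapping.lookup p x * Poly_Mapping.lookup q y)),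
     one = Poly_Mapping.single \<one>\<^bsub>G\<^esub> 1,
     ring.zero = 0,
     add = (+),
     module.smult = (\<lambda>c. Poly_Mapping.map ((*) c))\<rparr>"

definition linear_extension :: "('g \<Rightarrow> 'h) \<Rightarrow> ('g \<Rightarrow>\<^sub>0 complex) \<Rightarrow> ('h \<Rightarrow>\<^sub>0 complex)"
  where "linear_extension \<sigma> p =
    (\<Sum>x\<in>Poly_Mapping.keys p. Poly_Mapping.single (\<sigma> x) (Poly_Mapping.lookup p x))"

lemma cring_complex_field: "cring complex_field"
  by (rule cring_from_type_algebra)

lemma complex_field_simps [simp]:
  "carrier complex_field = UNIV" "a \<oplus>\<^bsub>complex_field\<^esub> b = a + b" "a \<otimes>\<^bsub>complex_field\<^esub> b = a * b"
  "\<zero>\<^bsub>complex_field\<^esub> = 0" "\<one>\<^bsub>complex_field\<^esub> = 1"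
  by (simp_all add: ring_of_type_algebra_def)

lemma complex_line_simps [simp]:
  "carrier complex_line = UNIV" "a \<oplus>\<^bsub>complex_line\<^esub> b = a + b" "a \<otimes>\<^bsub>complex_line\<^esub> b = a * b"
  "\<zero>\<^bsub>complex_line\<^esub> = 0" "\<one>\<^bsub>complex_line\<^esub> = 1" "a \<odot>\<^bsub>complex_line\<^esub> b = a * b"
  by (simp_all add: complex_line_def ring_of_type_algebra_def ring.defs)

lemma module_complex_line: "module complex_field complex_line"
proof (rule moduleI)
  show "abelian_group complex_line"
  proof (rule abelian_groupI)
    show "\<exists>y\<in>carrier complex_line. y \<oplus>\<^bsub>complex_line\<^esub> x = \<zero>\<^bsub>complex_line\<^esub>" for x
      by (intro bexI[of _ "- x"]) auto
  qed auto
qed (auto simp: cring_complex_field algebra_simps)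

lemma group_algebra_simps [simp]:
  "carrier (group_algebra G) = {p. Poly_Mapping.keys p \<subseteq> carrier G}"
  "\<one>\<^bsub>group_algebra G\<^esub> = Poly_Mapping.single \<one>\<^bsub>G\<^esub> 1"
  "\<zero>\<^bsub>group_algebra G\<^esub> = 0"
  "p \<oplus>\<^bsub>group_algebra G\<^esub> q = p + q"
  "c \<odot>\<^bsub>group_algebra G\<^esub> p = Poly_Mapping.map ((*) c) p"
  by (simp_all add: group_algebra_def)

lemma lookup_scale [simp]:
  "Poly_Mapping.lookup (Poly_Mapping.map ((*) c) p) x = (c :: complex) * Poly_Mapping.lookup p x"
  by (simp add: Poly_Mapping.map.rep_eq when_def)

lemma scale_diff:
  "Poly_Mapping.map ((*) (c :: complex)) (p - q) = Poly_Mapping.map ((*) c) p - Poly_Mapping.map ((*) c) q"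
  by (rule poly_mapping_eqI) (simp add: lookup_minus algebra_simps)

lemma keys_scale: "Poly_Mapping.keys (Poly_Mapping.map ((*) (c :: complex)) p) \<subseteq> Poly_Mapping.keys p"
  by (auto simp: in_keys_iff)

lemma group_algebra_mult_superset:
  assumes "finite A" "Poly_Mapping.keys p \<subseteq> A" "finite B" "Poly_Mapping.keys q \<subseteq> B"
  shows "p \<otimes>\<^bsub>group_algebra G\<^esub> q = (\<Sum>x\<in>A. \<Sum>y\<in>B.
    Poly_Mapping.single (x \<otimes>\<^bsub>G\<^esub> y) (Poly_Mapping.lookup p x * Poly_Mapping.lookup q y))"
proof -
  have "p \<otimes>\<^bsub>group_algebra G\<^esub> q = (\<Sum>x\<in>Poly_Mapping.keys p. \<Sum>y\<in>B.
    Poly_Mapping.single (x \<otimes>\<^bsub>G\<^esub> y) (Poly_Mapping.lookup p x * Poly_Mapping.lookup q y))"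
    unfolding group_algebra_def using assms
    by (simp, intro sum.cong refl sum.mono_neutral_left) (auto simp: in_keys_iff)
  also have "\<dots> = (\<Sum>x\<in>A. \<Sum>y\<in>B.
    Poly_Mapping.single (x \<otimes>\<^bsub>G\<^esub> y) (Poly_Mapping.lookup p x * Poly_Mapping.lookup q y))"
    using assms by (intro sum.mono_neutral_left) (auto simp: in_keys_iff)
  finally show ?thesis .
qed

lemma group_algebra_mult_single [simp]:
  "Poly_Mapping.single x a \<otimes>\<^bsub>group_algebra G\<^esub> Poly_Mapping.single y b =
    Poly_Mapping.single (x \<otimes>\<^bsub>G\<^esub> y) (a * b)"
  by (subst group_algebra_mult_superset[of "{x}" _ "{y}"]) (auto simp: lookup_single)

lemma group_algebra_add_mult:
  "(p + p') \<otimes>\<^bsub>group_algebra G\<^esub> q = p \<otimes>\<^bsub>group_algebra G\<^esub> q + p' \<otimes>\<^bsub>group_algebra G\<^esub> q"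
proof -
  let ?A = "Poly_Mapping.keys p \<union> Poly_Mapping.keys p'"
  show ?thesis
    using keys_add[of p p']
    by (simp add: group_algebra_mult_superset[of ?A _ "Poly_Mapping.keys q"] lookup_add
          distrib_right single_add sum.distrib)
qed

lemma group_algebra_mult_add:
  "q \<otimes>\<^bsub>group_algebra G\<^esub> (p + p') = q \<otimes>\<^bsub>group_algebra G\<^esub> p + q \<otimes>\<^bsub>group_algebra G\<^esub> p'"
proof -
  let ?A = "Poly_Mapping.keys p \<union> Poly_Mapping.keys p'"
  show ?thesis
    using keys_add[of p p']
    by (simp add: group_algebra_mult_superset[of "Poly_Mapping.keys q" _ ?A] lookup_add
          distrib_left single_add sum.distrib)
qed

lemma group_algebra_mult_zero [simp]:
  "0 \<otimes>\<^bsub>group_algebra G\<^esub> q = 0" "q \<otimes>\<^bsub>group_algebra G\<^esub> 0 = 0"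
  by (simp_all add: group_algebra_def)

lemma group_algebra_sum_mult:
  "(\<Sum>i\<in>I. f i) \<otimes>\<^bsub>group_algebra G\<^esub> q = (\<Sum>i\<in>I. f i \<otimes>\<^bsub>group_algebra G\<^esub> q)"
  by (induction I rule: infinite_finite_induct) (simp_all add: group_algebra_add_mult)

lemma group_algebra_mult_sum:
  "q \<otimes>\<^bsub>group_algebra G\<^esub> (\<Sum>i\<in>I. f i) = (\<Sum>i\<in>I. q \<otimes>\<^bsub>group_algebra G\<^esub> f i)"
  by (induction I rule: infinite_finite_induct) (simp_all add: group_algebra_mult_add)

lemma poly_mapping_eq_sum_single:
  "(\<Sum>x\<in>Poly_Mapping.keys p. Poly_Mapping.single x (Poly_Mapping.lookup p x)) = p"
proof (rule poly_mapping_eqI)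
  fix k
  show "Poly_Mapping.lookup (\<Sum>x\<in>Poly_Mapping.keys p. Poly_Mapping.single x (Poly_Mapping.lookup p x)) k
      = Poly_Mapping.lookup p k"
    by (cases "k \<in> Poly_Mapping.keys p")
      (auto simp: lookup_sum lookup_single when_def in_keys_iff)
qed

lemma group_algebra_scale_mult:
  "Poly_Mapping.map ((*) c) p \<otimes>\<^bsub>group_algebra G\<^esub> q = Poly_Mapping.map ((*) c) (p \<otimes>\<^bsub>group_algebra G\<^esub> q)"
  "p \<otimes>\<^bsub>group_algebra G\<^esub> Poly_Mapping.map ((*) c) q = Poly_Mapping.map ((*) c) (p \<otimes>\<^bsub>group_algebra G\<^esub> q)"
  by (rule poly_mapping_eqI,
      simp add: group_algebra_mult_superset[where A = "Poly_Mapping.keys p" and B = "Poly_Mapping.keys q"]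
        keys_scale lookup_sum lookup_single sum_distrib_left when_def ac_simps
        if_distrib[of "(*) c"] cong: if_cong)+

lemma (in monoid) group_algebra_closed:
  assumes "Poly_Mapping.keys p \<subseteq> carrier G" "Poly_Mapping.keys q \<subseteq> carrier G"
  shows "Poly_Mapping.keys (p \<otimes>\<^bsub>group_algebra G\<^esub> q) \<subseteq> carrier G"
  unfolding group_algebra_def using assms
  by (auto dest!: subsetD[OF keys_sum] split: if_splits intro!: m_closed)

lemma module_group_algebra: "module complex_field (group_algebra G)"
proof (rule moduleI)
  show "abelian_group (group_algebra G)"
  proof (rule abelian_groupI)
    fix p assume "p \<in> carrier (group_algebra G)"
    then show "\<exists>q\<in>carrier (group_algebra G). q \<oplus>\<^bsub>group_algebra G\<^esub> p = \<zero>\<^bsub>group_algebra G\<^esub>"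
      by (intro bexI[of _ "- p"]) (auto simp: keys_minus)
  qed (use keys_add in \<open>force simp: algebra_simps\<close>)+
qed (use keys_scale in \<open>force simp: cring_complex_field lookup_add algebra_simps intro!: poly_mapping_eqI\<close>)+

lemma (in monoid) ring_group_algebra: "ring (group_algebra G)"
proof (rule ringI)
  show "abelian_group (group_algebra G)"
    using module_group_algebra[of G] by (simp add: module_def)
  show "Group.monoid (group_algebra G)"
  proof (rule monoidI)
    fix p assume p: "p \<in> carrier (group_algebra G)"
    have 1: "p = (\<Sum>x\<in>Poly_Mapping.keys p. Poly_Mapping.single x (Poly_Mapping.lookup p x))"
      by (simp add: poly_mapping_eq_sum_single)
    show "\<one>\<^bsub>group_algebra G\<^esub> \<otimes>\<^bsub>group_algebra G\<^esub> p = p" "p \<otimes>\<^bsub>group_algebra G\<^esub> \<one>\<^bsub>group_algebra G\<^esub> = p"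
      using p
      by (subst (1 2) 1, auto simp: group_algebra_mult_sum group_algebra_sum_mult intro!: sum.cong)+
    fix q r assume q: "q \<in> carrier (group_algebra G)" and r: "r \<in> carrier (group_algebra G)"
    have 2: "q = (\<Sum>x\<in>Poly_Mapping.keys q. Poly_Mapping.single x (Poly_Mapping.lookup q x))"
      by (simp add: poly_mapping_eq_sum_single)
    have 3: "r = (\<Sum>x\<in>Poly_Mapping.keys r. Poly_Mapping.single x (Poly_Mapping.lookup r x))"
      by (simp add: poly_mapping_eq_sum_single)
    show "(p \<otimes>\<^bsub>group_algebra G\<^esub> q) \<otimes>\<^bsub>group_algebra G\<^esub> r = p \<otimes>\<^bsub>group_algebra G\<^esub> (q \<otimes>\<^bsub>group_algebra G\<^esub> r)"
      using p q r
      by (subst (1 2) 1, subst (1 2) 2, subst (1 2) 3)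
        (auto simp: group_algebra_mult_sum group_algebra_sum_mult m_assoc subset_iff mult.assoc
          intro!: sum.cong)
  qed (auto dest!: subsetD[OF group_algebra_closed, rotated 2])
qed (auto simp: group_algebra_add_mult group_algebra_mult_add)


section \<open>Twisted derivations\<close>

definition twisted_derivations ::
    "('g, 'm) monoid_scheme \<Rightarrow> ('g \<Rightarrow> 'g) \<Rightarrow> ('g \<Rightarrow> 'g) \<Rightarrow> (('g \<Rightarrow>\<^sub>0 complex) \<Rightarrow> ('g \<Rightarrow>\<^sub>0 complex)) set"
  where "twisted_derivations G \<sigma> \<tau> =
    {D \<in> linear_maps complex_field (group_algebra G) (group_algebra G).
       \<forall>a\<in>carrier (group_algebra G). \<forall>b\<in>carrier (group_algebra G).
         D (a \<otimes>\<^bsub>group_algebra G\<^esub> b) =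
           D a \<otimes>\<^bsub>group_algebra G\<^esub> linear_extension \<tau> b \<oplus>\<^bsub>group_algebra G\<^esub>
           linear_extension \<sigma> a \<otimes>\<^bsub>group_algebra G\<^esub> D b}"

definition inner_derivation ::
    "('g, 'm) monoid_scheme \<Rightarrow> ('g \<Rightarrow> 'g) \<Rightarrow> ('g \<Rightarrow> 'g) \<Rightarrow> ('g \<Rightarrow>\<^sub>0 complex) \<Rightarrow> ('g \<Rightarrow>\<^sub>0 complex) \<Rightarrow> ('g \<Rightarrow>\<^sub>0 complex)"
  where "inner_derivation G \<sigma> \<tau> p =
    (\<lambda>x\<in>carrier (group_algebra G).
       p \<otimes>\<^bsub>group_algebra G\<^esub> linear_extension \<tau> x \<ominus>\<^bsub>group_algebra G\<^esub>
       linear_extension \<sigma> x \<otimes>\<^bsub>group_algebra G\<^esub> p)"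

definition derivation_space ::
    "('g, 'm) monoid_scheme \<Rightarrow> ('g \<Rightarrow> 'g) \<Rightarrow> ('g \<Rightarrow> 'g) \<Rightarrow>
      (complex, ('g \<Rightarrow>\<^sub>0 complex) \<Rightarrow> ('g \<Rightarrow>\<^sub>0 complex)) module"
  where "derivation_space G \<sigma> \<tau> =
    (module_product (carrier (group_algebra G)) (\<lambda>_. group_algebra G))
      \<lparr>carrier := twisted_derivations G \<sigma> \<tau>\<rparr>"

definition inner_derivation_space ::
    "('g, 'm) monoid_scheme \<Rightarrow> ('g \<Rightarrow> 'g) \<Rightarrow> ('g \<Rightarrow> 'g) \<Rightarrow>
      (complex, ('g \<Rightarrow>\<^sub>0 complex) \<Rightarrow> ('g \<Rightarrow>\<^sub>0 complex)) module"
  where "inner_derivation_space G \<sigma> \<tau> =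
    (derivation_space G \<sigma> \<tau>)\<lparr>carrier := inner_derivation G \<sigma> \<tau> ` carrier (group_algebra G)\<rparr>"


section \<open>Twisted conjugacy\<close>

definition twisted_conj_class :: "('g, 'm) monoid_scheme \<Rightarrow> ('g \<Rightarrow> 'g) \<Rightarrow> ('g \<Rightarrow> 'g) \<Rightarrow> 'g \<Rightarrow> 'g set"
  where "twisted_conj_class G \<sigma> \<tau> a = {\<sigma> v \<otimes>\<^bsub>G\<^esub> a \<otimes>\<^bsub>G\<^esub> \<tau> (inv\<^bsub>G\<^esub> v) | v. v \<in> carrier G}"

definition twisted_conj_classes :: "('g, 'm) monoid_scheme \<Rightarrow> ('g \<Rightarrow> 'g) \<Rightarrow> ('g \<Rightarrow> 'g) \<Rightarrow> 'g set set"
  where "twisted_conj_classes G \<sigma> \<tau> = twisted_conj_class G \<sigma> \<tau> ` carrier G"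

definition twisted_centralizer :: "('g, 'm) monoid_scheme \<Rightarrow> ('g \<Rightarrow> 'g) \<Rightarrow> ('g \<Rightarrow> 'g) \<Rightarrow> 'g \<Rightarrow> 'g set"
  where "twisted_centralizer G \<sigma> \<tau> a = {z \<in> carrier G. \<sigma> z \<otimes>\<^bsub>G\<^esub> a = a \<otimes>\<^bsub>G\<^esub> \<tau> z}"

definition twisted_FC :: "('g, 'm) monoid_scheme \<Rightarrow> ('g \<Rightarrow> 'g) \<Rightarrow> ('g \<Rightarrow> 'g) \<Rightarrow> bool"
  where "twisted_FC G \<sigma> \<tau> \<longleftrightarrow> (\<forall>C \<in> twisted_conj_classes G \<sigma> \<tau>. finite C)"

definition finitely_generated_group :: "('g, 'm) monoid_scheme \<Rightarrow> bool"
  where "finitely_generated_group G \<longleftrightarrow>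
    (\<exists>S. finite S \<and> S \<subseteq> carrier G \<and> generate G S = carrier G)"

definition additive_characters :: "('g, 'm) monoid_scheme \<Rightarrow> (complex, 'g \<Rightarrow> complex) module"
  where "additive_characters H =
    (module_product (carrier H) (\<lambda>_. complex_line))
      \<lparr>carrier := hom H (add_monoid complex_field) \<inter> extensional (carrier H)\<rparr>"


section \<open>Well-definedness of the objects above\<close>

lemma complex_line_a_inv [simp]: "\<ominus>\<^bsub>complex_line\<^esub> x = - x"
proof -
  interpret module complex_field complex_line by (rule module_complex_line)
  show ?thesis by (rule M.minus_equality) auto
qed

lemma group_algebra_a_inv [simp]:
  assumes "Poly_Mapping.keys p \<subseteq> carrier G"
  shows "\<ominus>\<^bsub>group_algebra G\<^esub> p = - p"
proof -
  interpret module complex_field "group_algebra G" by (rule module_group_algebra)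
  show ?thesis using assms by (intro M.minus_equality) (auto simp: keys_minus)
qed

lemma module_additive_characters:
  assumes "monoid H"
  shows "module complex_field (additive_characters H)"
proof -
  interpret H: Group.monoid H by fact
  interpret P: module complex_field "module_product (carrier H) (\<lambda>_. complex_line)"
    by (intro module_module_product cring_complex_field module_complex_line)
  have "submodule (hom H (add_monoid complex_field) \<inter> extensional (carrier H)) complex_field
          (module_product (carrier H) (\<lambda>_. complex_line))"
    by (intro P.submoduleI)
      (auto simp: module_product_a_inv[OF cring_complex_field module_complex_line] PiE_iff
        hom_def algebra_simps extensional_def)
  from submodule.submodule_is_module[OF this P.module_axioms] show ?thesis
    by (simp add: additive_characters_def)
qed


lemma (in group) subgroup_twisted_centralizer:
  assumes \<sigma>: "\<sigma> \<in> hom G G" and \<tau>: "\<tau> \<in> hom G G" and a: "a \<in> carrier G"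
  shows "subgroup (twisted_centralizer G \<sigma> \<tau> a) G"
proof -
  interpret \<sigma>: group_hom G G \<sigma>
    using \<sigma> by (simp add: group_hom_def group_hom_axioms_def)
  interpret \<tau>: group_hom G G \<tau>
    using \<tau> by (simp add: group_hom_def group_hom_axioms_def)
  show ?thesis
  proof (rule subgroupI)
    show "twisted_centralizer G \<sigma> \<tau> a \<noteq> {}"
      using a by (auto simp: twisted_centralizer_def intro!: exI[of _ \<one>])
    fix x y assume x: "x \<in> twisted_centralizer G \<sigma> \<tau> a" and y: "y \<in> twisted_centralizer G \<sigma> \<tau> a"
    have xc: "x \<in> carrier G" "y \<in> carrier G"
      and eq: "\<sigma> x \<otimes> a = a \<otimes> \<tau> x" "\<sigma> y \<otimes> a = a \<otimes> \<tau> y"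
      using x y by (auto simp: twisted_centralizer_def)
    have "\<sigma> x \<otimes> \<sigma> y \<otimes> a = \<sigma> x \<otimes> (a \<otimes> \<tau> y)"
      using xc a eq by (simp add: m_assoc)
    also have "\<dots> = a \<otimes> (\<tau> x \<otimes> \<tau> y)"
      using xc a eq(1) by (simp add: m_assoc[symmetric])
    finally show "x \<otimes> y \<in> twisted_centralizer G \<sigma> \<tau> a"
      using xc by (simp add: twisted_centralizer_def)
    have "a = inv (\<sigma> x) \<otimes> (a \<otimes> \<tau> x)"
      using xc a by (simp add: eq(1)[symmetric] m_assoc[symmetric])
    then have "a \<otimes> inv (\<tau> x) = inv (\<sigma> x) \<otimes> a"
      using xc a by (metis inv_solve_right' m_assoc m_closed inv_closed \<sigma>.hom_closed \<tau>.hom_closed)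
    then show "inv x \<in> twisted_centralizer G \<sigma> \<tau> a"
      using xc by (simp add: twisted_centralizer_def)
  qed (auto simp: twisted_centralizer_def)
qed

lemma linear_extension_superset:
  assumes "finite A" "Poly_Mapping.keys p \<subseteq> A"
  shows "linear_extension \<sigma> p = (\<Sum>x\<in>A. Poly_Mapping.single (\<sigma> x) (Poly_Mapping.lookup p x))"
  unfolding linear_extension_def using assms
  by (intro sum.mono_neutral_left) (auto simp: in_keys_iff)

lemma linear_extension_single [simp]:
  "linear_extension \<sigma> (Poly_Mapping.single x a) = Poly_Mapping.single (\<sigma> x) a"
  by (subst linear_extension_superset[of "{x}"]) auto

lemma linear_extension_zero [simp]: "linear_extension \<sigma> 0 = 0"
  by (simp add: linear_extension_def)

lemma linear_extension_add:
  "linear_extension \<sigma> (p + q) = linear_extension \<sigma> p + linear_extension \<sigma> q"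
  using keys_add[of p q]
  by (simp add: linear_extension_superset[of "Poly_Mapping.keys p \<union> Poly_Mapping.keys q"] lookup_add
        single_add sum.distrib)

lemma linear_extension_sum:
  "linear_extension \<sigma> (\<Sum>i\<in>I. f i) = (\<Sum>i\<in>I. linear_extension \<sigma> (f i))"
  by (induction I rule: infinite_finite_induct) (simp_all add: linear_extension_add)

lemma linear_extension_scale:
  "linear_extension \<sigma> (Poly_Mapping.map ((*) c) p) = Poly_Mapping.map ((*) c) (linear_extension \<sigma> p)"
  by (rule poly_mapping_eqI)
    (auto simp: linear_extension_superset[where A = "Poly_Mapping.keys p"] keys_scale lookup_sum
      lookup_single sum_distrib_left when_def intro!: sum.cong)

lemma linear_extension_closed:
  assumes "\<sigma> \<in> hom G H" "Poly_Mapping.keys p \<subseteq> carrier G"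
  shows "Poly_Mapping.keys (linear_extension \<sigma> p) \<subseteq> carrier H"
  unfolding linear_extension_def using assms
  by (auto dest!: subsetD[OF keys_sum] split: if_splits simp: hom_def)

lemma linear_extension_mult:
  assumes "\<sigma> \<in> hom G H" "Poly_Mapping.keys p \<subseteq> carrier G" "Poly_Mapping.keys q \<subseteq> carrier G"
  shows "linear_extension \<sigma> (p \<otimes>\<^bsub>group_algebra G\<^esub> q) =
    linear_extension \<sigma> p \<otimes>\<^bsub>group_algebra H\<^esub> linear_extension \<sigma> q"
proof -
  have "linear_extension \<sigma> (p \<otimes>\<^bsub>group_algebra G\<^esub> q) =
    (\<Sum>x\<in>Poly_Mapping.keys p. \<Sum>y\<in>Poly_Mapping.keys q.
       Poly_Mapping.single (\<sigma> (x \<otimes>\<^bsub>G\<^esub> y)) (Poly_Mapping.lookup p x * Poly_Mapping.lookup q y))"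
    by (simp add: group_algebra_def linear_extension_sum)
  also have "\<dots> = (\<Sum>x\<in>Poly_Mapping.keys p. \<Sum>y\<in>Poly_Mapping.keys q.
       Poly_Mapping.single (\<sigma> x \<otimes>\<^bsub>H\<^esub> \<sigma> y) (Poly_Mapping.lookup p x * Poly_Mapping.lookup q y))"
    using assms by (intro sum.cong refl) (auto simp: hom_mult subset_iff)
  also have "\<dots> = linear_extension \<sigma> p \<otimes>\<^bsub>group_algebra H\<^esub> linear_extension \<sigma> q"
    unfolding linear_extension_def[of _ p] linear_extension_def[of _ q]
    unfolding group_algebra_sum_mult unfolding group_algebra_mult_sum by simp
  finally show ?thesis .
qed

lemma submodule_twisted_derivations:
  assumes "monoid G" and \<sigma>: "\<sigma> \<in> hom G G" and \<tau>: "\<tau> \<in> hom G G"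
  shows "submodule (twisted_derivations G \<sigma> \<tau>) complex_field
    (module_product (carrier (group_algebra G)) (\<lambda>_. group_algebra G))"
proof -
  interpret G: Group.monoid G by fact
  interpret A: ring "group_algebra G" by (rule G.ring_group_algebra)
  interpret P: module complex_field "module_product (carrier (group_algebra G)) (\<lambda>_. group_algebra G)"
    by (intro module_module_product cring_complex_field module_group_algebra)
  note [simp] = G.group_algebra_closed linear_extension_closed[OF \<sigma>] linear_extension_closed[OF \<tau>]
    group_algebra_add_mult group_algebra_mult_add group_algebra_scale_mult
  have keys: "Poly_Mapping.keys (p + q) \<subseteq> carrier G" "Poly_Mapping.keys (Poly_Mapping.map ((*) c) p) \<subseteq> carrier G"
    "Poly_Mapping.keys (- p) \<subseteq> carrier G"
    if "Poly_Mapping.keys p \<subseteq> carrier G" "Poly_Mapping.keys q \<subseteq> carrier G"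
    for c and p q :: "'a \<Rightarrow>\<^sub>0 complex"
    using that keys_add[of p q] keys_scale[of c p] by (auto simp: keys_minus)
  have scale: "Poly_Mapping.map ((*) c) (p + q) = Poly_Mapping.map ((*) c) p + Poly_Mapping.map ((*) c) q"
    "Poly_Mapping.map ((*) c) (Poly_Mapping.map ((*) d) p) =
     Poly_Mapping.map ((*) d) (Poly_Mapping.map ((*) c) p)"
    "Poly_Mapping.map ((*) (- 1)) p = - p" for c d and p q :: "'a \<Rightarrow>\<^sub>0 complex"
    by (rule poly_mapping_eqI, simp add: lookup_add algebra_simps)+
  let ?H = "twisted_derivations G \<sigma> \<tau>"
  let ?M = "module_product (carrier (group_algebra G)) (\<lambda>_. group_algebra G)"
  have smult: "c \<odot>\<^bsub>?M\<^esub> D \<in> ?H" if D: "D \<in> ?H" for c D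
    using D by (auto simp: twisted_derivations_def linear_maps_def PiE_iff keys scale)
  show ?thesis
  proof (rule P.submoduleI)
    show "?H \<subseteq> carrier ?M"
      by (auto simp: twisted_derivations_def linear_maps_def)
    show "\<zero>\<^bsub>?M\<^esub> \<in> ?H"
      by (auto simp: twisted_derivations_def linear_maps_def keys intro!: poly_mapping_eqI)
    show add: "D \<oplus>\<^bsub>?M\<^esub> E \<in> ?H" if D: "D \<in> ?H" and E: "E \<in> ?H" for D E
      using D E by (auto simp: twisted_derivations_def linear_maps_def PiE_iff keys scale algebra_simps)
    show "\<ominus>\<^bsub>?M\<^esub> D \<in> ?H" if D: "D \<in> ?H" for D
    proof -
      have "D \<in> carrier ?M"
        using D by (auto simp: twisted_derivations_def linear_maps_def)
      then have "\<ominus>\<^bsub>?M\<^esub> D = (- 1) \<odot>\<^bsub>?M\<^esub> D"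
        by (subst module_product_a_inv[OF cring_complex_field module_group_algebra])
          (auto simp: scale PiE_iff intro!: restrict_ext)
      then show ?thesis
        using smult[OF D] by simp
    qed
  qed (rule smult)
qed

lemma module_derivation_space:
  assumes "monoid G" "\<sigma> \<in> hom G G" "\<tau> \<in> hom G G"
  shows "module complex_field (derivation_space G \<sigma> \<tau>)"
  unfolding derivation_space_def
  by (intro submodule.submodule_is_module submodule_twisted_derivations assms
      module_module_product cring_complex_field module_group_algebra)

lemma inner_derivation_eq:
  assumes "monoid G" "\<sigma> \<in> hom G G" "\<tau> \<in> hom G G" "p \<in> carrier (group_algebra G)" "x \<in> carrier (group_algebra G)"
  shows "inner_derivation G \<sigma> \<tau> p x =
    p \<otimes>\<^bsub>group_algebra G\<^esub> linear_extension \<tau> x - linear_extension \<sigma> x \<otimes>\<^bsub>group_algebra G\<^esub> p"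
  using assms
  by (simp add: inner_derivation_def a_minus_def monoid.group_algebra_closed linear_extension_closed)

lemma inner_derivation_in_twisted_derivations:
  assumes "monoid G" and \<sigma>: "\<sigma> \<in> hom G G" and \<tau>: "\<tau> \<in> hom G G" and p: "p \<in> carrier (group_algebra G)"
  shows "inner_derivation G \<sigma> \<tau> p \<in> twisted_derivations G \<sigma> \<tau>"
proof -
  interpret G: Group.monoid G by fact
  interpret A: ring "group_algebra G" by (rule G.ring_group_algebra)
  interpret M: module complex_field "group_algebra G" by (rule module_group_algebra)
  let ?D = "inner_derivation G \<sigma> \<tau> p"
  note eq = inner_derivation_eq[OF assms]
  have cl: "linear_extension \<tau> x \<in> carrier (group_algebra G)" "linear_extension \<sigma> x \<in> carrier (group_algebra G)"
    if "x \<in> carrier (group_algebra G)" for x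
    using that linear_extension_closed[OF \<sigma>] linear_extension_closed[OF \<tau>] by auto
  have diff: "(u - v) \<otimes>\<^bsub>group_algebra G\<^esub> w = u \<otimes>\<^bsub>group_algebra G\<^esub> w - v \<otimes>\<^bsub>group_algebra G\<^esub> w"
    "w \<otimes>\<^bsub>group_algebra G\<^esub> (u - v) = w \<otimes>\<^bsub>group_algebra G\<^esub> u - w \<otimes>\<^bsub>group_algebra G\<^esub> v" for u v w
    using group_algebra_add_mult[where p = "u - v" and p' = v and q = w and G = G]
      group_algebra_mult_add[where p = "u - v" and p' = v and q = w and G = G]
    by (simp_all add: algebra_simps)
  have "?D \<in> carrier (group_algebra G) \<rightarrow>\<^sub>E carrier (group_algebra G)"
    unfolding inner_derivation_def
    using p by (intro restrict_PiE_iff[THEN iffD2] ballI A.minus_closed A.m_closed cl)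
  moreover have "?D (x \<oplus>\<^bsub>group_algebra G\<^esub> y) = ?D x \<oplus>\<^bsub>group_algebra G\<^esub> ?D y"
    if "x \<in> carrier (group_algebra G)" "y \<in> carrier (group_algebra G)" for x y
    using that A.a_closed[OF that]
    by (simp only: eq) (simp add: linear_extension_add group_algebra_add_mult group_algebra_mult_add)
  moreover have "?D (c \<odot>\<^bsub>group_algebra G\<^esub> x) = c \<odot>\<^bsub>group_algebra G\<^esub> ?D x"
    if "x \<in> carrier (group_algebra G)" for c x
    using that M.smult_closed[of c x]
    by (simp only: eq complex_field_simps UNIV_I)
      (simp add: linear_extension_scale group_algebra_scale_mult scale_diff)
  moreover have "?D (x \<otimes>\<^bsub>group_algebra G\<^esub> y) =
      ?D x \<otimes>\<^bsub>group_algebra G\<^esub> linear_extension \<tau> y \<oplus>\<^bsub>group_algebra G\<^esub>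
      linear_extension \<sigma> x \<otimes>\<^bsub>group_algebra G\<^esub> ?D y"
    if xy: "x \<in> carrier (group_algebra G)" "y \<in> carrier (group_algebra G)" for x y
  proof -
    have "linear_extension \<sigma> (x \<otimes>\<^bsub>group_algebra G\<^esub> y) =
        linear_extension \<sigma> x \<otimes>\<^bsub>group_algebra G\<^esub> linear_extension \<sigma> y"
      "linear_extension \<tau> (x \<otimes>\<^bsub>group_algebra G\<^esub> y) =
        linear_extension \<tau> x \<otimes>\<^bsub>group_algebra G\<^esub> linear_extension \<tau> y"
      using xy linear_extension_mult[OF \<sigma>] linear_extension_mult[OF \<tau>] by auto
    with xy show ?thesis
      unfolding eq[OF xy(1)] eq[OF xy(2)] eq[OF A.m_closed[OF xy]]
      using p by (simp add: diff A.m_assoc cl del: group_algebra_simps(1))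
  qed
  ultimately show ?thesis
    unfolding twisted_derivations_def linear_maps_def by blast
qed

lemma module_inner_derivation_space:
  assumes "monoid G" and \<sigma>: "\<sigma> \<in> hom G G" and \<tau>: "\<tau> \<in> hom G G"
  shows "module complex_field (inner_derivation_space G \<sigma> \<tau>)"
proof -
  interpret G: Group.monoid G by fact
  interpret M: module complex_field "group_algebra G" by (rule module_group_algebra)
  interpret D: module complex_field "derivation_space G \<sigma> \<tau>"
    by (intro module_derivation_space assms)
  note eq = inner_derivation_eq[OF assms]
  let ?I = "inner_derivation G \<sigma> \<tau> ` carrier (group_algebra G)"
  have add: "inner_derivation G \<sigma> \<tau> p \<oplus>\<^bsub>derivation_space G \<sigma> \<tau>\<^esub> inner_derivation G \<sigma> \<tau> q =
      inner_derivation G \<sigma> \<tau> (p + q)"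
    if "p \<in> carrier (group_algebra G)" "q \<in> carrier (group_algebra G)" for p q
  proof -
    have "inner_derivation G \<sigma> \<tau> (p + q) x = inner_derivation G \<sigma> \<tau> p x + inner_derivation G \<sigma> \<tau> q x"
      if "x \<in> carrier (group_algebra G)" for x
      using \<open>p \<in> _\<close> \<open>q \<in> _\<close> that M.a_closed[of p q]
      by (simp only: eq group_algebra_simps(4)) (simp add: group_algebra_add_mult group_algebra_mult_add)
    then show ?thesis
      by (intro ext) (simp add: derivation_space_def restrict_def, simp add: inner_derivation_def)
  qed
  have smult: "c \<odot>\<^bsub>derivation_space G \<sigma> \<tau>\<^esub> inner_derivation G \<sigma> \<tau> p =
      inner_derivation G \<sigma> \<tau> (c \<odot>\<^bsub>group_algebra G\<^esub> p)"
    if "p \<in> carrier (group_algebra G)" for c p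
  proof -
    have "inner_derivation G \<sigma> \<tau> (c \<odot>\<^bsub>group_algebra G\<^esub> p) x =
        c \<odot>\<^bsub>group_algebra G\<^esub> inner_derivation G \<sigma> \<tau> p x"
      if "x \<in> carrier (group_algebra G)" for x
      using \<open>p \<in> _\<close> that M.smult_closed[of c p]
      by (simp only: eq complex_field_simps UNIV_I)
        (simp add: group_algebra_scale_mult scale_diff)
    then show ?thesis
      by (intro ext) (simp add: derivation_space_def restrict_def, simp add: inner_derivation_def)
  qed
  have sub: "?I \<subseteq> carrier (derivation_space G \<sigma> \<tau>)"
    using inner_derivation_in_twisted_derivations[OF assms] by (auto simp: derivation_space_def)
  have "submodule ?I complex_field (derivation_space G \<sigma> \<tau>)"
  proof (rule D.submoduleI)
    show sm: "c \<odot>\<^bsub>derivation_space G \<sigma> \<tau>\<^esub> f \<in> ?I" if "f \<in> ?I" for c f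
      using that smult M.smult_closed[of c] by (auto simp del: group_algebra_simps)
    show "f \<oplus>\<^bsub>derivation_space G \<sigma> \<tau>\<^esub> g \<in> ?I" if "f \<in> ?I" "g \<in> ?I" for f g
      using that add M.a_closed by (auto simp: group_algebra_simps(4) simp del: group_algebra_simps(1))
    have "0 \<in> carrier (group_algebra G)" by simp
    then have I0: "inner_derivation G \<sigma> \<tau> 0 \<in> ?I" by blast
    show "\<zero>\<^bsub>derivation_space G \<sigma> \<tau>\<^esub> \<in> ?I"
      using sm[OF I0, of 0] D.smult_l_null[OF subsetD[OF sub I0]] by (simp only: complex_field_simps)
    show "\<ominus>\<^bsub>derivation_space G \<sigma> \<tau>\<^esub> f \<in> ?I" if f: "f \<in> ?I" for f
    proof -
      have "\<ominus>\<^bsub>complex_field\<^esub> 1 \<odot>\<^bsub>derivation_space G \<sigma> \<tau>\<^esub> f = \<ominus>\<^bsub>derivation_space G \<sigma> \<tau>\<^esub> f"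
        using D.smult_l_minus[of 1 f] D.smult_one[of f] f sub by auto
      then show ?thesis using sm[OF f, of "\<ominus>\<^bsub>complex_field\<^esub> 1"] by simp
    qed
  qed (rule sub)
  from submodule.submodule_is_module[OF this D.module_axioms] show ?thesis
    by (simp add: inner_derivation_space_def)
qed

end

theory Submission
  imports Defs
begin

text \<open>
  The group acts on itself by $g \cdot x = \sigma(g)\, x\, \tau(g)^{-1}$. The orbits are the
  twisted conjugacy classes and the stabilizer of \<open>a\<close> is its twisted centralizer.
  For a twisted derivation \<open>D\<close> put $\varphi_g = D(g)\,\tau(g)^{-1}$. The Leibniz rule for $D(gh)$
  becomes $\varphi_{gh} = \varphi_g + g \cdot \varphi_h$, so derivations are the same thing as
  1-cocycles of \<open>G\<close> with values in the permutation module $\mathbb{C}[G]$, and the inner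
  derivation of \<open>p\<close> is the coboundary $g \mapsto p - g \cdot p$. The theorem is therefore
  Shapiro's lemma: on a finite orbit of \<open>a\<close> with stabilizer \<open>Z\<close>, cohomology in degree one
  is $\mathrm{Hom}(Z, \mathbb{C})$.

  Concretely, the coefficient at \<open>a\<close> of the restriction of $\varphi$ to \<open>Z\<close> is
  a homomorphism, and doing this at all representatives gives a linear map from derivations to
  characters. It has a linear section, because a character of \<open>Z\<close> can be
  induced to a cocycle on the orbit after choosing for every point \<open>x\<close> an element moving the
  representative to \<open>x\<close>. Its kernel is the space of inner derivations
  (\<open>inner_derivations_eq_kernel\<close>): if the characters vanish, the
  values of the cocycle on the chosen elements are the coefficients of a \<open>p\<close> whose
  coboundary it is. A linear map with a section splits its source as target plus kernel
  (\<open>split_module_isomorphic\<close>).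

  The two finiteness hypotheses make all supports finite. Finite generation confines the whole
  cocycle to the finitely many classes that carry its values on generators
  (\<open>finite_cocycle_support_classes\<close>), so only finitely many characters are nonzero; finiteness
  of the classes makes \<open>p\<close> and the induced cocycles finitely supported.
\<close>


section \<open>Splitting a module along a retraction\<close>

text \<open>
  The isomorphism is $x \mapsto (r(x), x - s(r(x)))$, with inverse $(y, k) \mapsto k + s(y)$.
\<close>

lemma split_module_isomorphic:
  assumes "module R M" and "module R N"
    and r: "r \<in> linear_maps R M N" and s: "s \<in> linear_maps R N M"
    and rs: "\<And>y. y \<in> carrier N \<Longrightarrow> r (s y) = y"
    and K: "K = {x \<in> carrier M. r x = \<zero>\<^bsub>N\<^esub>}"
  shows "module_isomorphic R M (module_DirProd N (M\<lparr>carrier := K\<rparr>))"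
proof -
  interpret M: module R M by fact
  interpret N: module R N by fact
  have rc [simp]: "r x \<in> carrier N" if "x \<in> carrier M" for x
    using r that by (auto simp: linear_maps_def)
  have sc [simp]: "s y \<in> carrier M" if "y \<in> carrier N" for y
    using s that by (auto simp: linear_maps_def)
  have radd: "r (x \<oplus>\<^bsub>M\<^esub> y) = r x \<oplus>\<^bsub>N\<^esub> r y" if "x \<in> carrier M" "y \<in> carrier M" for x y
    using r that by (auto simp: linear_maps_def)
  have sadd: "s (x \<oplus>\<^bsub>N\<^esub> y) = s x \<oplus>\<^bsub>M\<^esub> s y" if "x \<in> carrier N" "y \<in> carrier N" for x y
    using s that by (auto simp: linear_maps_def)
  have rsm: "r (c \<odot>\<^bsub>M\<^esub> x) = c \<odot>\<^bsub>N\<^esub> r x" if "x \<in> carrier M" "c \<in> carrier R" for c x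
    using r that by (auto simp: linear_maps_def)
  have ssm: "s (c \<odot>\<^bsub>N\<^esub> x) = c \<odot>\<^bsub>M\<^esub> s x" if "x \<in> carrier N" "c \<in> carrier R" for c x
    using s that by (auto simp: linear_maps_def)
  let ?e = "\<lambda>x. x \<ominus>\<^bsub>M\<^esub> s (r x)"
  have e_add: "?e x \<oplus>\<^bsub>M\<^esub> s (r x) = x" if "x \<in> carrier M" for x
    using that by (simp add: M.minus_eq M.a_assoc M.l_neg)
  have eK: "?e x \<in> K" if x: "x \<in> carrier M" for x
  proof -
    have "r (?e x) \<oplus>\<^bsub>N\<^esub> r x = r (?e x \<oplus>\<^bsub>M\<^esub> s (r x))"
      using x by (simp add: radd rs)
    also have "\<dots> = \<zero>\<^bsub>N\<^esub> \<oplus>\<^bsub>N\<^esub> r x"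
      using x by (simp add: e_add)
    finally have "r (?e x) = \<zero>\<^bsub>N\<^esub>"
      using x by (subst (asm) N.add.r_cancel) auto
    then show ?thesis
      using x by (simp add: K)
  qed
  let ?D = "module_DirProd N (M\<lparr>carrier := K\<rparr>)"
  let ?f = "\<lambda>x\<in>carrier M. (r x, ?e x)"
  have "?f \<in> linear_maps R M ?D"
    unfolding linear_maps_def
  proof (intro CollectI conjI ballI)
    show "?f \<in> carrier M \<rightarrow>\<^sub>E carrier ?D"
      using eK by auto
    fix x y assume x: "x \<in> carrier M" and y: "y \<in> carrier M"
    then show "?f (x \<oplus>\<^bsub>M\<^esub> y) = ?f x \<oplus>\<^bsub>?D\<^esub> ?f y"
      by (simp add: radd sadd M.minus_eq M.minus_add M.a_ac)
  next
    fix c x assume c: "c \<in> carrier R" and x: "x \<in> carrier M"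
    then show "?f (c \<odot>\<^bsub>M\<^esub> x) = c \<odot>\<^bsub>?D\<^esub> ?f x"
      by (simp add: rsm ssm M.minus_eq M.smult_r_distr M.smult_r_minus)
  qed
  moreover have "bij_betw ?f (carrier M) (carrier ?D)"
  proof (rule bij_betw_byWitness[where f' = "\<lambda>(y, k). k \<oplus>\<^bsub>M\<^esub> s y"])
    show "\<forall>x\<in>carrier M. (case ?f x of (y, k) \<Rightarrow> k \<oplus>\<^bsub>M\<^esub> s y) = x"
      by (simp add: e_add)
    show "\<forall>u\<in>carrier ?D. ?f (case u of (y, k) \<Rightarrow> k \<oplus>\<^bsub>M\<^esub> s y) = u"
      by (auto simp: K radd rs M.minus_eq M.a_assoc M.r_neg)
    show "?f ` carrier M \<subseteq> carrier ?D"
      using eK by auto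
    show "(\<lambda>(y, k). k \<oplus>\<^bsub>M\<^esub> s y) ` carrier ?D \<subseteq> carrier M"
      by (auto simp: K)
  qed
  ultimately show ?thesis
    unfolding module_isomorphic_def by blast
qed


section \<open>The twisted conjugation action\<close>

locale twisted_conjugation = group G for G (structure) +
  fixes \<sigma> \<tau> :: "'a \<Rightarrow> 'a"
  assumes \<sigma>_hom: "\<sigma> \<in> hom G G" and \<tau>_hom: "\<tau> \<in> hom G G"
begin

sublocale \<sigma>: group_hom G G \<sigma>
  by unfold_locales (rule \<sigma>_hom)

sublocale \<tau>: group_hom G G \<tau>
  by unfold_locales (rule \<tau>_hom)

text \<open>
  The inverse is outside \<open>\<tau>\<close> here, whereas the definition of a twisted conjugacy class has it
  inside; the two agree only on the carrier.
\<close>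

definition act :: "'a \<Rightarrow> 'a \<Rightarrow> 'a"
  where "act g x = \<sigma> g \<otimes> x \<otimes> inv (\<tau> g)"

lemma act_closed [simp]: "g \<in> carrier G \<Longrightarrow> x \<in> carrier G \<Longrightarrow> act g x \<in> carrier G"
  by (simp add: act_def)

lemma act_one [simp]: "x \<in> carrier G \<Longrightarrow> act \<one> x = x"
  by (simp add: act_def)

lemma act_mult:
  "g \<in> carrier G \<Longrightarrow> h \<in> carrier G \<Longrightarrow> x \<in> carrier G \<Longrightarrow> act (g \<otimes> h) x = act g (act h x)"
  by (simp add: act_def m_assoc inv_mult_group)

lemma act_inv_cancel [simp]:
  assumes "g \<in> carrier G" "x \<in> carrier G"
  shows "act (inv g) (act g x) = x" and "act g (act (inv g) x) = x"
  using assms by (simp_all add: act_mult[symmetric])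

lemma act_inv_eq_iff:
  assumes "g \<in> carrier G" "x \<in> carrier G" "y \<in> carrier G"
  shows "act (inv g) x = y \<longleftrightarrow> x = act g y"
  using assms by auto

lemma twisted_conj_class_eq_orbit: "twisted_conj_class G \<sigma> \<tau> x = (\<lambda>v. act v x) ` carrier G"
  unfolding twisted_conj_class_def Setcompr_eq_image
  by (rule image_cong) (simp_all add: act_def)

lemma twisted_centralizer_eq_stabilizer:
  assumes "a \<in> carrier G"
  shows "twisted_centralizer G \<sigma> \<tau> a = {z \<in> carrier G. act z a = a}"
  using assms by (auto simp: twisted_centralizer_def act_def inv_solve_right')

lemma twisted_conj_class_self: "x \<in> carrier G \<Longrightarrow> x \<in> twisted_conj_class G \<sigma> \<tau> x"
  by (auto simp: twisted_conj_class_eq_orbit intro!: image_eqI[of _ _ \<one>])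

lemma twisted_conj_class_act:
  assumes g: "g \<in> carrier G" and x: "x \<in> carrier G"
  shows "twisted_conj_class G \<sigma> \<tau> (act g x) = twisted_conj_class G \<sigma> \<tau> x"
proof -
  have "act v (act g x) \<in> twisted_conj_class G \<sigma> \<tau> x" if "v \<in> carrier G" for v
    using that g x by (auto simp: twisted_conj_class_eq_orbit act_mult intro!: image_eqI[of _ _ "v \<otimes> g"])
  moreover have "act v x \<in> twisted_conj_class G \<sigma> \<tau> (act g x)" if "v \<in> carrier G" for v
    using that g x
    by (auto simp: twisted_conj_class_eq_orbit act_mult intro!: image_eqI[of _ _ "v \<otimes> inv g"])
  ultimately show ?thesis
    by (auto simp: twisted_conj_class_eq_orbit)
qed

lemma twisted_conj_classes_member:
  assumes "C \<in> twisted_conj_classes G \<sigma> \<tau>" "x \<in> C"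
  shows "x \<in> carrier G" and "twisted_conj_class G \<sigma> \<tau> x = C"
proof -
  obtain c v where "c \<in> carrier G" "C = twisted_conj_class G \<sigma> \<tau> c" "v \<in> carrier G" "x = act v c"
    using assms by (auto simp: twisted_conj_classes_def twisted_conj_class_eq_orbit)
  then show "x \<in> carrier G" and "twisted_conj_class G \<sigma> \<tau> x = C"
    by (simp_all add: twisted_conj_class_act)
qed


section \<open>Derivations as cocycles\<close>

text \<open>
  A family $\varphi_g = \sum_x \varphi\,g\,x \cdot x$ of elements of the group algebra with
  $\varphi_{gh} = \varphi_g + g \cdot \varphi_h$; the coefficient of $g \cdot \varphi_h$ at \<open>x\<close> is
  that of $\varphi_h$ at $g^{-1} \cdot x$.
\<close>

definition twisted_cocycle :: "('a \<Rightarrow> 'a \<Rightarrow> complex) \<Rightarrow> bool"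
  where "twisted_cocycle \<phi> \<longleftrightarrow>
    (\<forall>g\<in>carrier G. \<forall>h\<in>carrier G. \<forall>x\<in>carrier G. \<phi> (g \<otimes> h) x = \<phi> g x + \<phi> h (act (inv g) x)) \<and>
    (\<forall>g\<in>carrier G. finite {x \<in> carrier G. \<phi> g x \<noteq> 0})"

text \<open>
  The coefficient of $D(g)\,\tau(g)^{-1}$ at \<open>x\<close>, read off from $D(g)$ so that no product in the
  group algebra is needed.
\<close>

definition coefficient :: "(('a \<Rightarrow>\<^sub>0 complex) \<Rightarrow> ('a \<Rightarrow>\<^sub>0 complex)) \<Rightarrow> 'a \<Rightarrow> 'a \<Rightarrow> complex"
  where "coefficient D g x = Poly_Mapping.lookup (D (Poly_Mapping.single g 1)) (x \<otimes> \<tau> g)"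

text \<open>
  The element $\varphi_g\,\tau(g)$, which is the value at \<open>g\<close> of the derivation
  belonging to the cocycle.
\<close>

definition cocycle_value :: "('a \<Rightarrow> 'a \<Rightarrow> complex) \<Rightarrow> 'a \<Rightarrow> ('a \<Rightarrow>\<^sub>0 complex)"
  where "cocycle_value \<phi> g =
    Abs_poly_mapping (\<lambda>y. if y \<in> carrier G then \<phi> g (y \<otimes> inv (\<tau> g)) else 0)"

definition derivation_of :: "('a \<Rightarrow> 'a \<Rightarrow> complex) \<Rightarrow> ('a \<Rightarrow>\<^sub>0 complex) \<Rightarrow> ('a \<Rightarrow>\<^sub>0 complex)"
  where "derivation_of \<phi> = (\<lambda>p\<in>carrier (group_algebra G).
    \<Sum>g\<in>Poly_Mapping.keys p. Poly_Mapping.map ((*) (Poly_Mapping.lookup p g)) (cocycle_value \<phi> g))"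

lemma single_eq_scale:
  "Poly_Mapping.single x c = Poly_Mapping.map ((*) c) (Poly_Mapping.single x (1 :: complex))"
  by (rule poly_mapping_eqI) (simp add: lookup_single when_def)

lemma scale_scale:
  "Poly_Mapping.map ((*) c) (Poly_Mapping.map ((*) d) p) = Poly_Mapping.map ((*) (c * d :: complex)) p"
  by (rule poly_mapping_eqI) simp

lemma lookup_mult_single:
  assumes "Poly_Mapping.keys p \<subseteq> carrier G" "h \<in> carrier G" "y \<in> carrier G"
  shows "Poly_Mapping.lookup (p \<otimes>\<^bsub>group_algebra G\<^esub> Poly_Mapping.single h c) y =
    Poly_Mapping.lookup p (y \<otimes> inv h) * c"
proof -
  have "Poly_Mapping.lookup (p \<otimes>\<^bsub>group_algebra G\<^esub> Poly_Mapping.single h c) y =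
      (\<Sum>x\<in>Poly_Mapping.keys p. if x = y \<otimes> inv h then Poly_Mapping.lookup p x * c else 0)"
    using assms
    by (subst group_algebra_mult_superset[of "Poly_Mapping.keys p" _ "{h}"])
      (auto simp: lookup_sum lookup_single when_def inv_solve_right subset_iff intro!: sum.cong)
  then show ?thesis
    by (auto simp: sum.delta in_keys_iff)
qed

lemma lookup_single_mult:
  assumes "Poly_Mapping.keys p \<subseteq> carrier G" "h \<in> carrier G" "y \<in> carrier G"
  shows "Poly_Mapping.lookup (Poly_Mapping.single h c \<otimes>\<^bsub>group_algebra G\<^esub> p) y =
    c * Poly_Mapping.lookup p (inv h \<otimes> y)"
proof -
  have "Poly_Mapping.lookup (Poly_Mapping.single h c \<otimes>\<^bsub>group_algebra G\<^esub> p) y =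
      (\<Sum>x\<in>Poly_Mapping.keys p. if x = inv h \<otimes> y then c * Poly_Mapping.lookup p x else 0)"
    using assms
    by (subst group_algebra_mult_superset[of "{h}" _ "Poly_Mapping.keys p"])
      (auto simp: lookup_sum lookup_single when_def inv_solve_left subset_iff intro!: sum.cong)
  then show ?thesis
    by (auto simp: sum.delta in_keys_iff)
qed

lemma derivation_keys:
  assumes "D \<in> twisted_derivations G \<sigma> \<tau>" "Poly_Mapping.keys p \<subseteq> carrier G"
  shows "Poly_Mapping.keys (D p) \<subseteq> carrier G"
  using assms by (auto simp: twisted_derivations_def linear_maps_def PiE_iff)

lemma derivation_mult:
  assumes "D \<in> twisted_derivations G \<sigma> \<tau>"
    "Poly_Mapping.keys p \<subseteq> carrier G" "Poly_Mapping.keys q \<subseteq> carrier G"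
  shows "D (p \<otimes>\<^bsub>group_algebra G\<^esub> q) =
    D p \<otimes>\<^bsub>group_algebra G\<^esub> linear_extension \<tau> q + linear_extension \<sigma> p \<otimes>\<^bsub>group_algebra G\<^esub> D q"
  using assms by (auto simp: twisted_derivations_def)

lemma twisted_cocycle_coefficient:
  assumes D: "D \<in> twisted_derivations G \<sigma> \<tau>"
  shows "twisted_cocycle (coefficient D)"
  unfolding twisted_cocycle_def
proof (intro conjI ballI)
  fix g h x assume g: "g \<in> carrier G" and h: "h \<in> carrier G" and x: "x \<in> carrier G"
  let ?s = "\<lambda>g. Poly_Mapping.single g (1 :: complex)"
  have "D (?s (g \<otimes> h)) =
      D (?s g) \<otimes>\<^bsub>group_algebra G\<^esub> ?s (\<tau> h) + ?s (\<sigma> g) \<otimes>\<^bsub>group_algebra G\<^esub> D (?s h)"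
    using derivation_mult[OF D, of "?s g" "?s h"] g h by simp
  then show "coefficient D (g \<otimes> h) x = coefficient D g x + coefficient D h (act (inv g) x)"
    using g h x derivation_keys[OF D, of "?s g"] derivation_keys[OF D, of "?s h"]
    by (simp add: coefficient_def lookup_add lookup_mult_single lookup_single_mult act_def m_assoc)
next
  fix g assume g: "g \<in> carrier G"
  let ?K = "Poly_Mapping.keys (D (Poly_Mapping.single g 1))"
  have "{x \<in> carrier G. coefficient D g x \<noteq> 0} \<subseteq> (\<lambda>y. y \<otimes> inv (\<tau> g)) ` ?K"
    using g by (auto simp: coefficient_def in_keys_iff m_assoc intro!: image_eqI[of _ _ "_ \<otimes> \<tau> g"])
  then show "finite {x \<in> carrier G. coefficient D g x \<noteq> 0}"
    by (rule finite_subset) simp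
qed

text \<open>
  The group elements are a basis of the group algebra, so a linear map is determined by its values
  on them.
\<close>

lemma linear_map_eq_sum:
  assumes "D \<in> linear_maps complex_field (group_algebra G) (group_algebra G)"
    and "Poly_Mapping.keys p \<subseteq> carrier G"
  shows "D p = (\<Sum>g\<in>Poly_Mapping.keys p.
    Poly_Mapping.map ((*) (Poly_Mapping.lookup p g)) (D (Poly_Mapping.single g 1)))"
proof -
  have add: "D (u + v) = D u + D v"
    if "Poly_Mapping.keys u \<subseteq> carrier G" "Poly_Mapping.keys v \<subseteq> carrier G" for u v
    using assms(1) that by (auto simp: linear_maps_def)
  have scale: "D (Poly_Mapping.map ((*) c) u) = Poly_Mapping.map ((*) c) (D u)"
    if "Poly_Mapping.keys u \<subseteq> carrier G" for c u
    using assms(1) that by (auto simp: linear_maps_def)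
  have D0: "D 0 = 0"
    using add[of 0 0] by simp
  have sum: "D (\<Sum>g\<in>A. Poly_Mapping.single g (c g)) = (\<Sum>g\<in>A. D (Poly_Mapping.single g (c g)))"
    if "finite A" "A \<subseteq> carrier G" for A c
    using that
  proof (induction A)
    case (insert a A)
    then show ?case
      by (auto simp: add dest!: subsetD[OF keys_sum] split: if_splits)
        (subst add, auto dest!: subsetD[OF keys_sum] split: if_splits)
  qed (simp add: D0)
  have "D p = D (\<Sum>g\<in>Poly_Mapping.keys p. Poly_Mapping.single g (Poly_Mapping.lookup p g))"
    by (simp add: poly_mapping_eq_sum_single)
  also have "\<dots> = (\<Sum>g\<in>Poly_Mapping.keys p. D (Poly_Mapping.single g (Poly_Mapping.lookup p g)))"
    using assms(2) by (intro sum) auto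
  also have "\<dots> = (\<Sum>g\<in>Poly_Mapping.keys p.
      Poly_Mapping.map ((*) (Poly_Mapping.lookup p g)) (D (Poly_Mapping.single g 1)))"
  proof (rule sum.cong[OF refl])
    fix g assume "g \<in> Poly_Mapping.keys p"
    then have "g \<in> carrier G"
      using assms(2) by auto
    then show "D (Poly_Mapping.single g (Poly_Mapping.lookup p g)) =
        Poly_Mapping.map ((*) (Poly_Mapping.lookup p g)) (D (Poly_Mapping.single g 1))"
      using scale[of "Poly_Mapping.single g 1" "Poly_Mapping.lookup p g"]
      by (subst single_eq_scale) simp
  qed
  finally show ?thesis .
qed

lemma derivation_eqI:
  assumes D: "D \<in> twisted_derivations G \<sigma> \<tau>" and E: "E \<in> twisted_derivations G \<sigma> \<tau>"
    and eq: "\<And>g x. g \<in> carrier G \<Longrightarrow> x \<in> carrier G \<Longrightarrow> coefficient D g x = coefficient E g x"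
  shows "D = E"
proof -
  have single: "D (Poly_Mapping.single g 1) = E (Poly_Mapping.single g 1)" if g: "g \<in> carrier G" for g
  proof (rule poly_mapping_eqI)
    fix y
    show "Poly_Mapping.lookup (D (Poly_Mapping.single g 1)) y =
        Poly_Mapping.lookup (E (Poly_Mapping.single g 1)) y"
    proof (cases "y \<in> carrier G")
      case True
      then show ?thesis
        using eq[of g "y \<otimes> inv (\<tau> g)"] g by (simp add: coefficient_def m_assoc)
    next
      case False
      moreover have "Poly_Mapping.keys (Poly_Mapping.single g (1 :: complex)) \<subseteq> carrier G"
        using g by simp
      ultimately have "y \<notin> Poly_Mapping.keys (D (Poly_Mapping.single g 1))"
        "y \<notin> Poly_Mapping.keys (E (Poly_Mapping.single g 1))"
        using derivation_keys[OF D] derivation_keys[OF E] by blast+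
      then show ?thesis
        by (simp add: in_keys_iff)
    qed
  qed
  have lin: "D \<in> linear_maps complex_field (group_algebra G) (group_algebra G)"
    "E \<in> linear_maps complex_field (group_algebra G) (group_algebra G)"
    using D E by (auto simp: twisted_derivations_def)
  have "D p = E p" if "p \<in> carrier (group_algebra G)" for p
    using that linear_map_eq_sum[OF lin(1), of p] linear_map_eq_sum[OF lin(2), of p]
    by (auto simp: single subset_iff intro!: sum.cong)
  moreover have "D \<in> extensional (carrier (group_algebra G))" "E \<in> extensional (carrier (group_algebra G))"
    using lin by (auto simp: linear_maps_def PiE_def)
  ultimately show ?thesis
    by (intro extensionalityI)
qed

context
  fixes \<phi> assumes \<phi>: "twisted_cocycle \<phi>"
begin

lemma lookup_cocycle_value:
  assumes "g \<in> carrier G"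
  shows "Poly_Mapping.lookup (cocycle_value \<phi> g) y =
    (if y \<in> carrier G then \<phi> g (y \<otimes> inv (\<tau> g)) else 0)"
proof -
  let ?S = "{x \<in> carrier G. \<phi> g x \<noteq> 0}"
  have "finite ?S"
    using \<phi> assms by (simp add: twisted_cocycle_def)
  moreover have "{y. (if y \<in> carrier G then \<phi> g (y \<otimes> inv (\<tau> g)) else 0) \<noteq> 0} \<subseteq> (\<lambda>x. x \<otimes> \<tau> g) ` ?S"
  proof (rule subsetI)
    fix y assume "y \<in> {y. (if y \<in> carrier G then \<phi> g (y \<otimes> inv (\<tau> g)) else 0) \<noteq> 0}"
    then show "y \<in> (\<lambda>x. x \<otimes> \<tau> g) ` ?S"
      using assms by (intro image_eqI[of _ _ "y \<otimes> inv (\<tau> g)"]) (auto simp: m_assoc split: if_splits)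
  qed
  ultimately have "finite {y. (if y \<in> carrier G then \<phi> g (y \<otimes> inv (\<tau> g)) else 0) \<noteq> 0}"
    by (meson finite_imageI finite_subset)
  then show ?thesis
    by (simp add: cocycle_value_def Abs_poly_mapping_inverse)
qed

lemma keys_cocycle_value: "g \<in> carrier G \<Longrightarrow> Poly_Mapping.keys (cocycle_value \<phi> g) \<subseteq> carrier G"
  by (auto simp: in_keys_iff lookup_cocycle_value split: if_splits)

lemma cocycle_value_mult:
  assumes "g \<in> carrier G" "h \<in> carrier G"
  shows "cocycle_value \<phi> (g \<otimes> h) =
    cocycle_value \<phi> g \<otimes>\<^bsub>group_algebra G\<^esub> Poly_Mapping.single (\<tau> h) 1 +
    Poly_Mapping.single (\<sigma> g) 1 \<otimes>\<^bsub>group_algebra G\<^esub> cocycle_value \<phi> h" (is "?l = ?r")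
proof (rule poly_mapping_eqI)
  fix y
  show "Poly_Mapping.lookup ?l y = Poly_Mapping.lookup ?r y"
  proof (cases "y \<in> carrier G")
    case True
    have "\<phi> (g \<otimes> h) (y \<otimes> inv (\<tau> (g \<otimes> h))) =
        \<phi> g (y \<otimes> inv (\<tau> (g \<otimes> h))) + \<phi> h (act (inv g) (y \<otimes> inv (\<tau> (g \<otimes> h))))"
      using \<phi> assms True by (simp add: twisted_cocycle_def)
    also have "y \<otimes> inv (\<tau> (g \<otimes> h)) = y \<otimes> inv (\<tau> h) \<otimes> inv (\<tau> g)"
      using assms True by (simp add: inv_mult_group m_assoc)
    also have "act (inv g) \<dots> = inv (\<sigma> g) \<otimes> y \<otimes> inv (\<tau> h)"
      using assms True by (simp add: act_def m_assoc)
    finally show ?thesis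
      using assms True
      by (simp add: lookup_cocycle_value lookup_add lookup_mult_single lookup_single_mult
          keys_cocycle_value inv_mult_group m_assoc)
  next
    case False
    have "Poly_Mapping.keys ?r \<subseteq> carrier G"
      by (rule order.trans[OF keys_add])
        (use assms in \<open>auto dest!: subsetD[OF group_algebra_closed, rotated 2]
           simp: keys_cocycle_value subsetD[OF keys_cocycle_value]\<close>)
    then show ?thesis
      using False assms by (auto simp: lookup_cocycle_value in_keys_iff)
  qed
qed

lemma derivation_of_superset:
  assumes "Poly_Mapping.keys p \<subseteq> A" "finite A" "A \<subseteq> carrier G"
  shows "derivation_of \<phi> p =
    (\<Sum>g\<in>A. Poly_Mapping.map ((*) (Poly_Mapping.lookup p g)) (cocycle_value \<phi> g))"
proof -
  have "derivation_of \<phi> p = (\<Sum>g\<in>Poly_Mapping.keys p.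
      Poly_Mapping.map ((*) (Poly_Mapping.lookup p g)) (cocycle_value \<phi> g))"
    using assms by (auto simp: derivation_of_def)
  also have "\<dots> = (\<Sum>g\<in>A. Poly_Mapping.map ((*) (Poly_Mapping.lookup p g)) (cocycle_value \<phi> g))"
    using assms by (intro sum.mono_neutral_left) (auto simp: in_keys_iff intro!: poly_mapping_eqI)
  finally show ?thesis .
qed

lemma derivation_of_single:
  assumes "g \<in> carrier G"
  shows "derivation_of \<phi> (Poly_Mapping.single g c) = Poly_Mapping.map ((*) c) (cocycle_value \<phi> g)"
  using assms by (subst derivation_of_superset[of _ "{g}"]) auto

lemma coefficient_derivation_of:
  assumes "g \<in> carrier G" "x \<in> carrier G"
  shows "coefficient (derivation_of \<phi>) g x = \<phi> g x"
  using assms by (simp add: coefficient_def derivation_of_single lookup_cocycle_value m_assoc)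

lemma derivation_of_linear:
  "derivation_of \<phi> \<in> linear_maps complex_field (group_algebra G) (group_algebra G)"
  unfolding linear_maps_def
proof (intro CollectI conjI ballI)
  show "derivation_of \<phi> \<in> carrier (group_algebra G) \<rightarrow>\<^sub>E carrier (group_algebra G)"
    by (auto simp: derivation_of_def
        dest!: subsetD[OF keys_sum] subsetD[OF keys_scale] subsetD[OF keys_cocycle_value, rotated])
  fix p q assume pq: "p \<in> carrier (group_algebra G)" "q \<in> carrier (group_algebra G)"
  let ?A = "Poly_Mapping.keys p \<union> Poly_Mapping.keys q"
  show "derivation_of \<phi> (p \<oplus>\<^bsub>group_algebra G\<^esub> q) =
      derivation_of \<phi> p \<oplus>\<^bsub>group_algebra G\<^esub> derivation_of \<phi> q"
    using pq keys_add[of p q]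
    by (intro poly_mapping_eqI)
      (simp add: derivation_of_superset[of _ ?A] lookup_sum lookup_add distrib_right sum.distrib)
next
  fix c p assume p: "p \<in> carrier (group_algebra G)"
  then show "derivation_of \<phi> (c \<odot>\<^bsub>group_algebra G\<^esub> p) = c \<odot>\<^bsub>group_algebra G\<^esub> derivation_of \<phi> p"
    using keys_scale[of c p]
    by (intro poly_mapping_eqI)
      (simp add: derivation_of_superset[of _ "Poly_Mapping.keys p"] lookup_sum sum_distrib_left mult.assoc)
qed


text \<open>
  Both sides of the Leibniz rule are bilinear, so it reduces to group elements, where it is
  \<open>cocycle_value_mult\<close>.
\<close>

lemma derivation_of_in_twisted_derivations: "derivation_of \<phi> \<in> twisted_derivations G \<sigma> \<tau>"
proof -
  let ?D = "derivation_of \<phi>"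
  have D_add: "?D (u + v) = ?D u + ?D v"
    if "Poly_Mapping.keys u \<subseteq> carrier G" "Poly_Mapping.keys v \<subseteq> carrier G" for u v
    using derivation_of_linear that by (auto simp: linear_maps_def)
  have D_sum: "?D (sum f A) = (\<Sum>i\<in>A. ?D (f i))" and keys_f: "Poly_Mapping.keys (sum f A) \<subseteq> carrier G"
    if "finite A" "\<And>i. i \<in> A \<Longrightarrow> Poly_Mapping.keys (f i) \<subseteq> carrier G"
    for A :: "'a set" and f
  proof -
    have "?D (sum f A) = (\<Sum>i\<in>A. ?D (f i)) \<and> Poly_Mapping.keys (sum f A) \<subseteq> carrier G"
      using that
    proof (induction A)
      case empty
      show ?case by (simp add: derivation_of_def)
    next
      case (insert i A)
      then show ?case
        using keys_add[of "f i" "sum f A"] by (auto simp: D_add)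
    qed
    then show "?D (sum f A) = (\<Sum>i\<in>A. ?D (f i))" and "Poly_Mapping.keys (sum f A) \<subseteq> carrier G"
      by auto
  qed
  have "?D (p \<otimes>\<^bsub>group_algebra G\<^esub> q) = ?D p \<otimes>\<^bsub>group_algebra G\<^esub> linear_extension \<tau> q +
      linear_extension \<sigma> p \<otimes>\<^bsub>group_algebra G\<^esub> ?D q"
    if p: "Poly_Mapping.keys p \<subseteq> carrier G" and q: "Poly_Mapping.keys q \<subseteq> carrier G" for p q
  proof -
    let ?P = "Poly_Mapping.keys p" and ?Q = "Poly_Mapping.keys q"
    let ?a = "Poly_Mapping.lookup p" and ?b = "Poly_Mapping.lookup q"
    let ?L = "\<lambda>g h. Poly_Mapping.map ((*) (?a g)) (cocycle_value \<phi> g) \<otimes>\<^bsub>group_algebra G\<^esub>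
        Poly_Mapping.single (\<tau> h) (?b h)"
    let ?R = "\<lambda>g h. Poly_Mapping.single (\<sigma> g) (?a g) \<otimes>\<^bsub>group_algebra G\<^esub>
        Poly_Mapping.map ((*) (?b h)) (cocycle_value \<phi> h)"
    have "p \<otimes>\<^bsub>group_algebra G\<^esub> q =
        (\<Sum>g\<in>?P. \<Sum>h\<in>?Q. Poly_Mapping.single (g \<otimes> h) (?a g * ?b h))"
      by (rule group_algebra_mult_superset) auto
    then have "?D (p \<otimes>\<^bsub>group_algebra G\<^esub> q) =
        ?D (\<Sum>g\<in>?P. \<Sum>h\<in>?Q. Poly_Mapping.single (g \<otimes> h) (?a g * ?b h))"
      by (rule arg_cong)
    also have "\<dots> = (\<Sum>g\<in>?P. ?D (\<Sum>h\<in>?Q. Poly_Mapping.single (g \<otimes> h) (?a g * ?b h)))"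
    proof (rule D_sum)
      show "Poly_Mapping.keys (\<Sum>h\<in>?Q. Poly_Mapping.single (g \<otimes> h) (?a g * ?b h)) \<subseteq> carrier G"
        if "g \<in> ?P" for g
        by (rule keys_f) (use p q that in auto)
    qed simp
    also have "\<dots> = (\<Sum>g\<in>?P. \<Sum>h\<in>?Q. ?D (Poly_Mapping.single (g \<otimes> h) (?a g * ?b h)))"
      by (rule sum.cong[OF refl], rule D_sum) (use p q in auto)
    also have "\<dots> = (\<Sum>g\<in>?P. \<Sum>h\<in>?Q. ?L g h + ?R g h)"
    proof (intro sum.cong refl)
      fix g h assume "g \<in> ?P" "h \<in> ?Q"
      then have "g \<in> carrier G" "h \<in> carrier G"
        using p q by auto
      moreover have "?L g h = Poly_Mapping.map ((*) (?a g * ?b h))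
            (cocycle_value \<phi> g \<otimes>\<^bsub>group_algebra G\<^esub> Poly_Mapping.single (\<tau> h) 1)"
        "?R g h = Poly_Mapping.map ((*) (?a g * ?b h))
            (Poly_Mapping.single (\<sigma> g) 1 \<otimes>\<^bsub>group_algebra G\<^esub> cocycle_value \<phi> h)"
        by (subst single_eq_scale[of "\<tau> h" "?b h"],
            simp only: group_algebra_scale_mult scale_scale mult.commute)
          (subst single_eq_scale[of "\<sigma> g" "?a g"],
            simp only: group_algebra_scale_mult scale_scale mult.commute)
      ultimately show "?D (Poly_Mapping.single (g \<otimes> h) (?a g * ?b h)) = ?L g h + ?R g h"
        by (simp add: derivation_of_single cocycle_value_mult)
          (intro poly_mapping_eqI, simp add: lookup_add algebra_simps)
    qed
    also have "\<dots> = ?D p \<otimes>\<^bsub>group_algebra G\<^esub> linear_extension \<tau> q +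
        linear_extension \<sigma> p \<otimes>\<^bsub>group_algebra G\<^esub> ?D q"
      using p q unfolding linear_extension_def
      by (simp add: derivation_of_def group_algebra_sum_mult group_algebra_mult_sum
          sum.distrib sum.swap[of _ ?Q ?P])
    finally show ?thesis .
  qed
  with derivation_of_linear show ?thesis
    by (simp add: twisted_derivations_def)
qed

lemma cocycle_mult:
  "g \<in> carrier G \<Longrightarrow> h \<in> carrier G \<Longrightarrow> x \<in> carrier G \<Longrightarrow>
    \<phi> (g \<otimes> h) x = \<phi> g x + \<phi> h (act (inv g) x)"
  using \<phi> by (simp add: twisted_cocycle_def)

lemma cocycle_one: "x \<in> carrier G \<Longrightarrow> \<phi> \<one> x = 0"
  using cocycle_mult[of \<one> \<one> x] by simp

lemma cocycle_inv:
  "g \<in> carrier G \<Longrightarrow> x \<in> carrier G \<Longrightarrow> \<phi> (inv g) x = - \<phi> g (act g x)"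
  using cocycle_mult[of "inv g" g x] cocycle_one[of x] by (simp add: add_eq_0_iff)

text \<open>
  A class that misses the support of $\varphi_s$ for every generator \<open>s\<close> misses that of every $\varphi_g$, since the
  cocycle rule expresses $\varphi_g\,x$ through values of $\varphi_s$ at points of the class of \<open>x\<close>.
  Only finitely many classes meet the finitely many finite supports of the $\varphi_s$.
\<close>

lemma finite_cocycle_support_classes:
  assumes "finitely_generated_group G"
  shows "finite (twisted_conj_class G \<sigma> \<tau> ` {x \<in> carrier G. \<exists>g\<in>carrier G. \<phi> g x \<noteq> 0})"
proof -
  obtain S where S: "finite S" "S \<subseteq> carrier G" "generate G S = carrier G"
    using assms by (auto simp: finitely_generated_group_def)
  define K where "K = (\<Union>s\<in>S. twisted_conj_class G \<sigma> \<tau> ` {x \<in> carrier G. \<phi> s x \<noteq> 0})"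
  have "finite K"
    using S \<phi> by (auto simp: K_def twisted_cocycle_def)
  have vanish: "\<phi> g x = 0"
    if "g \<in> generate G S" "x \<in> carrier G" "twisted_conj_class G \<sigma> \<tau> x \<notin> K" for g x
    using that
  proof (induction g arbitrary: x rule: generate.induct)
    case one
    then show ?case by (simp add: cocycle_one)
  next
    case (incl s)
    then show ?case by (auto simp: K_def)
  next
    case (inv s)
    then have "s \<in> carrier G"
      using S by auto
    with inv have "act s x \<in> carrier G" "twisted_conj_class G \<sigma> \<tau> (act s x) \<notin> K"
      by (simp_all add: twisted_conj_class_act)
    moreover have "twisted_conj_class G \<sigma> \<tau> (act s x) \<in> K"
      if "\<phi> s (act s x) \<noteq> 0" "act s x \<in> carrier G"
      unfolding K_def by (rule UN_I[OF \<open>s \<in> S\<close>], rule imageI) (use that in simp)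
    ultimately have "\<phi> s (act s x) = 0"
      by metis
    with inv \<open>s \<in> carrier G\<close> show ?case
      by (simp add: cocycle_inv)
  next
    case (eng g h)
    then show ?case
      using S by (simp add: cocycle_mult twisted_conj_class_act)
  qed
  show ?thesis
    by (rule finite_subset[OF _ \<open>finite K\<close>]) (use vanish S in blast)
qed

end

lemma coefficient_inner_derivation:
  assumes "p \<in> carrier (group_algebra G)" "g \<in> carrier G" "x \<in> carrier G"
  shows "coefficient (inner_derivation G \<sigma> \<tau> p) g x =
    Poly_Mapping.lookup p x - Poly_Mapping.lookup p (act (inv g) x)"
  using assms
  by (simp add: coefficient_def inner_derivation_eq[OF is_monoid \<sigma>_hom \<tau>_hom] lookup_minus
      lookup_mult_single lookup_single_mult act_def m_assoc)

lemma coefficient_add: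
  assumes "g \<in> carrier G"
  shows "coefficient (D \<oplus>\<^bsub>derivation_space G \<sigma> \<tau>\<^esub> E) g x = coefficient D g x + coefficient E g x"
  using assms by (simp add: coefficient_def derivation_space_def lookup_add)

lemma coefficient_smult:
  assumes "g \<in> carrier G"
  shows "coefficient (c \<odot>\<^bsub>derivation_space G \<sigma> \<tau>\<^esub> D) g x = c * coefficient D g x"
  using assms by (simp add: coefficient_def derivation_space_def)

end


section \<open>Cocycles and characters of the stabilizers\<close>

locale twisted_conj_representatives = twisted_conjugation +
  fixes rep :: "'a set \<Rightarrow> 'a"
  assumes rep: "C \<in> twisted_conj_classes G \<sigma> \<tau> \<Longrightarrow> rep C \<in> C"
begin

abbreviation conj_class :: "'a \<Rightarrow> 'a set"
  where "conj_class \<equiv> twisted_conj_class G \<sigma> \<tau>"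

abbreviation conj_classes :: "'a set set"
  where "conj_classes \<equiv> twisted_conj_classes G \<sigma> \<tau>"

abbreviation stabilizer :: "'a set \<Rightarrow> 'a set"
  where "stabilizer C \<equiv> twisted_centralizer G \<sigma> \<tau> (rep C)"

abbreviation characters :: "(complex, 'a set \<Rightarrow> 'a \<Rightarrow> complex) module"
  where "characters \<equiv> module_direct_sum conj_classes
    (\<lambda>C. additive_characters (G\<lparr>carrier := stabilizer C\<rparr>))"

lemma rep_closed: "C \<in> conj_classes \<Longrightarrow> rep C \<in> carrier G"
  and conj_class_rep: "C \<in> conj_classes \<Longrightarrow> conj_class (rep C) = C"
  using twisted_conj_classes_member rep by blast+

lemma conj_class_in [simp]: "x \<in> carrier G \<Longrightarrow> conj_class x \<in> conj_classes"
  by (simp add: twisted_conj_classes_def)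

lemma stabilizer_iff:
  "C \<in> conj_classes \<Longrightarrow> z \<in> stabilizer C \<longleftrightarrow> z \<in> carrier G \<and> act z (rep C) = rep C"
  by (simp add: twisted_centralizer_eq_stabilizer rep_closed)

lemma stabilizer_inv:
  assumes "C \<in> conj_classes" "z \<in> stabilizer C"
  shows "inv z \<in> stabilizer C" and "act (inv z) (rep C) = rep C"
  using assms act_inv_cancel(1)[of z "rep C"] by (auto simp: stabilizer_iff rep_closed)

lemma module_characters: "module complex_field characters"
proof (rule module_module_direct_sum[OF cring_complex_field])
  fix C assume "C \<in> conj_classes"
  then have "subgroup (stabilizer C) G"
    by (intro subgroup_twisted_centralizer \<sigma>_hom \<tau>_hom rep_closed)
  then show "module complex_field (additive_characters (G\<lparr>carrier := stabilizer C\<rparr>))"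
    by (intro module_additive_characters group.is_monoid subgroup.subgroup_is_group is_group)
qed

text \<open>
  The zero of a space of characters is the extensional zero function, so for extensional families
  being nonzero at a class means taking a nonzero value on its stabilizer.
\<close>

lemma characters_iff:
  "\<chi> \<in> carrier characters \<longleftrightarrow>
    \<chi> \<in> extensional conj_classes \<and>
    (\<forall>C\<in>conj_classes. \<chi> C \<in> extensional (stabilizer C) \<and>
      (\<forall>z\<in>stabilizer C. \<forall>w\<in>stabilizer C. \<chi> C (z \<otimes> w) = \<chi> C z + \<chi> C w)) \<and>
    finite {C \<in> conj_classes. \<exists>z\<in>stabilizer C. \<chi> C z \<noteq> 0}"
proof -
  have zero: "f = (\<lambda>z\<in>A. 0) \<longleftrightarrow> (\<forall>z\<in>A. f z = 0)" if "f \<in> extensional A" for f :: "'a \<Rightarrow> complex" and A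
    using that by (auto simp: fun_eq_iff extensional_def)
  have "{C \<in> conj_classes. \<chi> C \<noteq> (\<lambda>z\<in>stabilizer C. 0)} = {C \<in> conj_classes. \<exists>z\<in>stabilizer C. \<chi> C z \<noteq> 0}"
    if "\<forall>C\<in>conj_classes. \<chi> C \<in> extensional (stabilizer C)"
    using that zero by auto
  then show ?thesis
    by (auto simp: module_direct_sum_def additive_characters_def PiE_iff hom_def)
qed

lemma characters_add:
  "C \<in> conj_classes \<Longrightarrow> z \<in> stabilizer C \<Longrightarrow> (\<chi> \<oplus>\<^bsub>characters\<^esub> \<psi>) C z = \<chi> C z + \<psi> C z"
  by (simp add: module_direct_sum_def additive_characters_def)

lemma characters_smult:
  "C \<in> conj_classes \<Longrightarrow> z \<in> stabilizer C \<Longrightarrow> (c \<odot>\<^bsub>characters\<^esub> \<chi>) C z = c * \<chi> C z"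
  by (simp add: module_direct_sum_def additive_characters_def)

lemma characters_eqI:
  assumes "\<chi> \<in> carrier characters" "\<psi> \<in> carrier characters"
    and "\<And>C z. C \<in> conj_classes \<Longrightarrow> z \<in> stabilizer C \<Longrightarrow> \<chi> C z = \<psi> C z"
  shows "\<chi> = \<psi>"
  using assms by (intro extensionalityI[of _ conj_classes] extensionalityI[of _ "stabilizer C" for C])
    (auto simp: characters_iff)

definition transporter :: "'a \<Rightarrow> 'a"
  where "transporter x = (SOME t. t \<in> carrier G \<and> act t (rep (conj_class x)) = x)"

lemma transporter:
  assumes "x \<in> carrier G"
  shows transporter_closed: "transporter x \<in> carrier G"
    and act_transporter: "act (transporter x) (rep (conj_class x)) = x"
proof -
  have "x \<in> conj_class (rep (conj_class x))"
    using assms by (simp add: conj_class_rep twisted_conj_class_self)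
  then have "\<exists>t. t \<in> carrier G \<and> act t (rep (conj_class x)) = x"
    by (auto simp: twisted_conj_class_eq_orbit)
  from someI_ex[OF this] show "transporter x \<in> carrier G" "act (transporter x) (rep (conj_class x)) = x"
    by (simp_all add: transporter_def)
qed

text \<open>
  Both $t_x$ and $g\,t_{g^{-1} \cdot x}$ move the representative to \<open>x\<close>, so they differ by an
  element of its stabilizer. As a function of \<open>g\<close> and \<open>x\<close> this is the cocycle that turns
  a representation of the stabilizer into the induced one.
\<close>

definition stabilizer_part :: "'a \<Rightarrow> 'a \<Rightarrow> 'a"
  where "stabilizer_part g x = inv (transporter x) \<otimes> g \<otimes> transporter (act (inv g) x)"

lemma stabilizer_part_in:
  assumes g: "g \<in> carrier G" and x: "x \<in> carrier G"
  shows "stabilizer_part g x \<in> stabilizer (conj_class x)"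
proof -
  let ?a = "rep (conj_class x)" and ?y = "act (inv g) x"
  have a: "?a \<in> carrier G"
    using x by (simp add: rep_closed)
  have y: "?y \<in> carrier G" "conj_class ?y = conj_class x"
    using g x by (simp_all add: twisted_conj_class_act)
  have "act (stabilizer_part g x) ?a = act (inv (transporter x)) (act g (act (transporter ?y) ?a))"
    using g x y a by (simp add: stabilizer_part_def act_mult transporter_closed)
  also have "\<dots> = act (inv (transporter x)) x"
    using act_transporter[OF y(1)] y g x by simp
  also have "\<dots> = ?a"
    using act_transporter[OF x] act_inv_cancel(1)[of "transporter x" ?a] transporter_closed[OF x] a by simp
  finally show ?thesis
    using g x y by (simp add: stabilizer_iff stabilizer_part_def transporter_closed)
qed

lemma stabilizer_part_mult:
  assumes "g \<in> carrier G" "h \<in> carrier G" "x \<in> carrier G"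
  shows "stabilizer_part (g \<otimes> h) x = stabilizer_part g x \<otimes> stabilizer_part h (act (inv g) x)"
proof -
  let ?t = "transporter (act (inv g) x)"
  have "?t \<otimes> (inv ?t \<otimes> u) = u" if "u \<in> carrier G" for u
    using assms that by (simp add: m_assoc[symmetric] transporter_closed)
  then show ?thesis
    using assms
    by (simp add: stabilizer_part_def m_assoc inv_mult_group act_mult transporter_closed)
qed

definition induced_cocycle :: "('a set \<Rightarrow> 'a \<Rightarrow> complex) \<Rightarrow> 'a \<Rightarrow> 'a \<Rightarrow> complex"
  where "induced_cocycle \<chi> g x = \<chi> (conj_class x) (stabilizer_part g x)"

lemma twisted_cocycle_induced:
  assumes FC: "twisted_FC G \<sigma> \<tau>" and \<chi>: "\<chi> \<in> carrier characters"
  shows "twisted_cocycle (induced_cocycle \<chi>)"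
  unfolding twisted_cocycle_def
proof (intro conjI ballI)
  fix g h x assume g: "g \<in> carrier G" and h: "h \<in> carrier G" and x: "x \<in> carrier G"
  have "conj_class (act (inv g) x) = conj_class x"
    using g x by (simp add: twisted_conj_class_act)
  then show "induced_cocycle \<chi> (g \<otimes> h) x =
      induced_cocycle \<chi> g x + induced_cocycle \<chi> h (act (inv g) x)"
    using \<chi> g h x stabilizer_part_in[OF g x] stabilizer_part_in[OF h, of "act (inv g) x"]
    by (simp add: induced_cocycle_def stabilizer_part_mult characters_iff)
next
  fix g assume g: "g \<in> carrier G"
  let ?K = "{C \<in> conj_classes. \<exists>z\<in>stabilizer C. \<chi> C z \<noteq> 0}"
  have "{x \<in> carrier G. induced_cocycle \<chi> g x \<noteq> 0} \<subseteq> \<Union>?K"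
  proof (rule subsetI)
    fix x assume "x \<in> {x \<in> carrier G. induced_cocycle \<chi> g x \<noteq> 0}"
    then have "x \<in> carrier G" "induced_cocycle \<chi> g x \<noteq> 0"
      by auto
    then have "conj_class x \<in> ?K"
      using stabilizer_part_in[OF g] by (auto simp: induced_cocycle_def)
    then show "x \<in> \<Union>?K"
      using twisted_conj_class_self[OF \<open>x \<in> carrier G\<close>] by blast
  qed
  moreover have "finite (\<Union>?K)"
    using \<chi> FC by (auto simp: characters_iff twisted_FC_def)
  ultimately show "finite {x \<in> carrier G. induced_cocycle \<chi> g x \<noteq> 0}"
    by (rule finite_subset)
qed

text \<open>
  The transporter of the representative need not be the identity, but it lies in the
  stabilizer. Hence the stabilizer part of \<open>z\<close> is a conjugate of \<open>z\<close> in the stabilizer, and a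
  character with values in an abelian group does not change under conjugation.
\<close>

lemma induced_cocycle_rep:
  assumes \<chi>: "\<chi> \<in> carrier characters" and C: "C \<in> conj_classes" and z: "z \<in> stabilizer C"
  shows "induced_cocycle \<chi> z (rep C) = \<chi> C z"
proof -
  let ?t = "transporter (rep C)"
  have rep: "rep C \<in> carrier G" "conj_class (rep C) = C"
    using C by (simp_all add: rep_closed conj_class_rep)
  have t: "?t \<in> stabilizer C"
    using act_transporter[OF rep(1)] transporter_closed[OF rep(1)] C by (simp add: stabilizer_iff rep)
  note t' = stabilizer_inv[OF C t] and z' = stabilizer_inv[OF C z]
  have closed: "?t \<in> carrier G" "z \<in> carrier G"
    using t z C by (auto simp: stabilizer_iff)
  have mult: "\<chi> C (u \<otimes> v) = \<chi> C u + \<chi> C v" if "u \<in> stabilizer C" "v \<in> stabilizer C" for u v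
    using \<chi> C that by (simp add: characters_iff)
  have one: "\<one> \<in> stabilizer C"
    using C rep by (simp add: stabilizer_iff)
  have "\<chi> C \<one> = 0"
    using mult[OF one one] by simp
  then have "\<chi> C (inv ?t) + \<chi> C ?t = 0"
    using mult[OF t'(1) t] closed by simp
  moreover have "inv ?t \<otimes> z \<in> stabilizer C"
    using t' z C closed rep by (simp add: stabilizer_iff act_mult)
  ultimately show ?thesis
    using mult[OF t'(1) z] mult[of "inv ?t \<otimes> z" ?t] t rep z'
    by (simp add: induced_cocycle_def stabilizer_part_def)
qed

text \<open>
  The projection of the splitting. On the stabilizer the cocycle rule at the fixed point
  \<open>rep C\<close> says that the coefficient is additive.
\<close>

definition stabilizer_restriction ::
    "(('a \<Rightarrow>\<^sub>0 complex) \<Rightarrow> ('a \<Rightarrow>\<^sub>0 complex)) \<Rightarrow> 'a set \<Rightarrow> 'a \<Rightarrow> complex"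
  where "stabilizer_restriction = (\<lambda>D\<in>twisted_derivations G \<sigma> \<tau>.
    \<lambda>C\<in>conj_classes. \<lambda>z\<in>stabilizer C. coefficient D z (rep C))"

lemma stabilizer_restriction_in:
  assumes fg: "finitely_generated_group G" and D: "D \<in> twisted_derivations G \<sigma> \<tau>"
  shows "stabilizer_restriction D \<in> carrier characters"
proof -
  note cocycle = twisted_cocycle_coefficient[OF D]
  have "coefficient D (z \<otimes> w) (rep C) = coefficient D z (rep C) + coefficient D w (rep C)"
    if "C \<in> conj_classes" "z \<in> stabilizer C" "w \<in> stabilizer C" for C z w
    using that stabilizer_inv(2)[of C z]
    by (simp add: cocycle_mult[OF cocycle] stabilizer_iff rep_closed)
  moreover have "z \<otimes> w \<in> stabilizer C"
    if "C \<in> conj_classes" "z \<in> stabilizer C" "w \<in> stabilizer C" for C z w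
    using that by (simp add: stabilizer_iff act_mult rep_closed)
  moreover have "finite {C \<in> conj_classes. \<exists>z\<in>stabilizer C. coefficient D z (rep C) \<noteq> 0}"
  proof (rule finite_subset)
    show "{C \<in> conj_classes. \<exists>z\<in>stabilizer C. coefficient D z (rep C) \<noteq> 0} \<subseteq>
        conj_class ` {x \<in> carrier G. \<exists>g\<in>carrier G. coefficient D g x \<noteq> 0}"
    proof (rule subsetI)
      fix C assume "C \<in> {C \<in> conj_classes. \<exists>z\<in>stabilizer C. coefficient D z (rep C) \<noteq> 0}"
      then show "C \<in> conj_class ` {x \<in> carrier G. \<exists>g\<in>carrier G. coefficient D g x \<noteq> 0}"
        by (intro image_eqI[of _ _ "rep C"]) (auto simp: conj_class_rep rep_closed stabilizer_iff)
    qed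
  qed (rule finite_cocycle_support_classes[OF cocycle fg])
  moreover have "{C \<in> conj_classes. \<exists>z\<in>stabilizer C. stabilizer_restriction D C z \<noteq> 0} =
      {C \<in> conj_classes. \<exists>z\<in>stabilizer C. coefficient D z (rep C) \<noteq> 0}"
    using D by (auto simp: stabilizer_restriction_def)
  ultimately show ?thesis
    using D unfolding characters_iff by (auto simp: stabilizer_restriction_def)
qed

lemma stabilizer_restriction_apply:
  assumes "D \<in> twisted_derivations G \<sigma> \<tau>" "C \<in> conj_classes" "z \<in> stabilizer C"
  shows "stabilizer_restriction D C z = coefficient D z (rep C)"
  using assms by (simp add: stabilizer_restriction_def)

lemma carrier_derivation_space: "carrier (derivation_space G \<sigma> \<tau>) = twisted_derivations G \<sigma> \<tau>"
  by (simp add: derivation_space_def)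

sublocale derivations: module complex_field "derivation_space G \<sigma> \<tau>"
  by (rule module_derivation_space[OF is_monoid \<sigma>_hom \<tau>_hom])

sublocale characters: module complex_field characters
  by (rule module_characters)

lemma stabilizer_restriction_linear:
  assumes fg: "finitely_generated_group G"
  shows "stabilizer_restriction \<in> linear_maps complex_field (derivation_space G \<sigma> \<tau>) characters"
  unfolding linear_maps_def
proof (intro CollectI conjI ballI)
  note closed = stabilizer_restriction_in[OF fg]
  show "stabilizer_restriction \<in> carrier (derivation_space G \<sigma> \<tau>) \<rightarrow>\<^sub>E carrier characters"
    using closed by (auto simp: carrier_derivation_space stabilizer_restriction_def)
  fix D E assume DE: "D \<in> carrier (derivation_space G \<sigma> \<tau>)" "E \<in> carrier (derivation_space G \<sigma> \<tau>)"
  have sum: "D \<oplus>\<^bsub>derivation_space G \<sigma> \<tau>\<^esub> E \<in> twisted_derivations G \<sigma> \<tau>"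
    using derivations.a_closed[OF DE] by (simp add: carrier_derivation_space)
  note DE = DE[unfolded carrier_derivation_space]
  show "stabilizer_restriction (D \<oplus>\<^bsub>derivation_space G \<sigma> \<tau>\<^esub> E) =
      stabilizer_restriction D \<oplus>\<^bsub>characters\<^esub> stabilizer_restriction E"
    by (rule characters_eqI)
      (use DE sum in \<open>auto simp: closed characters_add stabilizer_restriction_apply coefficient_add
         stabilizer_iff intro!: characters.a_closed\<close>)
next
  note closed = stabilizer_restriction_in[OF fg]
  fix c D assume c: "c \<in> carrier complex_field" and D: "D \<in> carrier (derivation_space G \<sigma> \<tau>)"
  have smult: "c \<odot>\<^bsub>derivation_space G \<sigma> \<tau>\<^esub> D \<in> twisted_derivations G \<sigma> \<tau>"
    using derivations.smult_closed[OF c D] by (simp add: carrier_derivation_space)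
  note D = D[unfolded carrier_derivation_space]
  show "stabilizer_restriction (c \<odot>\<^bsub>derivation_space G \<sigma> \<tau>\<^esub> D) =
      c \<odot>\<^bsub>characters\<^esub> stabilizer_restriction D"
    by (rule characters_eqI)
      (use c D smult in \<open>auto simp: closed characters_smult stabilizer_restriction_apply coefficient_smult
         stabilizer_iff intro!: characters.smult_closed\<close>)
qed

text \<open>
  The section of the projection: inducing a family of characters to a cocycle is linear because the
  transporters are chosen once and for all.
\<close>

definition induced_derivation ::
    "('a set \<Rightarrow> 'a \<Rightarrow> complex) \<Rightarrow> ('a \<Rightarrow>\<^sub>0 complex) \<Rightarrow> ('a \<Rightarrow>\<^sub>0 complex)"
  where "induced_derivation = (\<lambda>\<chi>\<in>carrier characters. derivation_of (induced_cocycle \<chi>))"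

context
  assumes FC: "twisted_FC G \<sigma> \<tau>"
begin

lemma induced_derivation_in:
  "\<chi> \<in> carrier characters \<Longrightarrow> induced_derivation \<chi> \<in> twisted_derivations G \<sigma> \<tau>"
  by (simp add: induced_derivation_def derivation_of_in_twisted_derivations twisted_cocycle_induced[OF FC])

lemma coefficient_induced_derivation:
  "\<chi> \<in> carrier characters \<Longrightarrow> g \<in> carrier G \<Longrightarrow> x \<in> carrier G \<Longrightarrow>
    coefficient (induced_derivation \<chi>) g x = \<chi> (conj_class x) (stabilizer_part g x)"
  by (simp add: induced_derivation_def coefficient_derivation_of twisted_cocycle_induced[OF FC]
      induced_cocycle_def)

lemma induced_derivation_linear:
  "induced_derivation \<in> linear_maps complex_field characters (derivation_space G \<sigma> \<tau>)"
  unfolding linear_maps_def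
proof (intro CollectI conjI ballI)
  note closed = induced_derivation_in
  show "induced_derivation \<in> carrier characters \<rightarrow>\<^sub>E carrier (derivation_space G \<sigma> \<tau>)"
    using closed by (auto simp: carrier_derivation_space induced_derivation_def)
  fix \<chi> \<psi> assume \<chi>\<psi>: "\<chi> \<in> carrier characters" "\<psi> \<in> carrier characters"
  note sum = characters.a_closed[OF \<chi>\<psi>]
  have "induced_derivation \<chi> \<oplus>\<^bsub>derivation_space G \<sigma> \<tau>\<^esub> induced_derivation \<psi> \<in> twisted_derivations G \<sigma> \<tau>"
    using derivations.a_closed closed \<chi>\<psi> by (simp add: carrier_derivation_space)
  then show "induced_derivation (\<chi> \<oplus>\<^bsub>characters\<^esub> \<psi>) =
      induced_derivation \<chi> \<oplus>\<^bsub>derivation_space G \<sigma> \<tau>\<^esub> induced_derivation \<psi>"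
    by (intro derivation_eqI closed sum)
      (simp_all add: coefficient_add coefficient_induced_derivation \<chi>\<psi> sum characters_add stabilizer_part_in)
next
  note closed = induced_derivation_in
  fix c \<chi> assume c: "c \<in> carrier complex_field" and \<chi>: "\<chi> \<in> carrier characters"
  note smult = characters.smult_closed[OF c \<chi>]
  have "c \<odot>\<^bsub>derivation_space G \<sigma> \<tau>\<^esub> induced_derivation \<chi> \<in> twisted_derivations G \<sigma> \<tau>"
    using derivations.smult_closed[OF c] closed \<chi> by (simp add: carrier_derivation_space)
  then show "induced_derivation (c \<odot>\<^bsub>characters\<^esub> \<chi>) =
      c \<odot>\<^bsub>derivation_space G \<sigma> \<tau>\<^esub> induced_derivation \<chi>"
    by (intro derivation_eqI closed smult)
      (simp_all add: coefficient_smult coefficient_induced_derivation \<chi> smult characters_smult stabilizer_part_in)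
qed

lemma restriction_induced_derivation:
  assumes fg: "finitely_generated_group G" and \<chi>: "\<chi> \<in> carrier characters"
  shows "stabilizer_restriction (induced_derivation \<chi>) = \<chi>"
proof (rule characters_eqI[OF stabilizer_restriction_in[OF fg induced_derivation_in[OF \<chi>]] \<chi>])
  fix C z assume C: "C \<in> conj_classes" and z: "z \<in> stabilizer C"
  then have "z \<in> carrier G" "rep C \<in> carrier G"
    by (auto simp: stabilizer_iff rep_closed)
  then show "stabilizer_restriction (induced_derivation \<chi>) C z = \<chi> C z"
    using induced_cocycle_rep[OF \<chi> C z] induced_derivation_in[OF \<chi>] C z \<chi>
    by (simp add: stabilizer_restriction_apply coefficient_induced_derivation induced_cocycle_def)
qed

text \<open>
  If $\varphi_g = p - g \cdot p$ with \<open>p\<close> vanishing at the representative \<open>a\<close>, then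
  $\varphi_{t_x}\,x = p(x) - p(a) = p(x)$; this forces the choice of \<open>p\<close>. It works because
  $g\,t_{g^{-1} \cdot x} = t_x z$ with \<open>z\<close> in the stabilizer, and evaluating $\varphi$ on the two
  products at \<open>x\<close> gives $\varphi_g\,x + p(g^{-1} \cdot x)$ and $p(x) + \varphi_z\,a = p(x)$.
\<close>

lemma inner_if_coefficients_vanish_on_stabilizers:
  assumes fg: "finitely_generated_group G" and D: "D \<in> twisted_derivations G \<sigma> \<tau>"
    and vanish: "\<And>C z. C \<in> conj_classes \<Longrightarrow> z \<in> stabilizer C \<Longrightarrow> coefficient D z (rep C) = 0"
  shows "D \<in> inner_derivation G \<sigma> \<tau> ` carrier (group_algebra G)"
proof -
  note cocycle = twisted_cocycle_coefficient[OF D]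
  note mult = cocycle_mult[OF cocycle]
  let ?t = transporter
  define f where "f x = (if x \<in> carrier G then coefficient D (?t x) x else 0)" for x
  let ?X = "{x \<in> carrier G. \<exists>g\<in>carrier G. coefficient D g x \<noteq> 0}"
  have "{x. f x \<noteq> 0} \<subseteq> \<Union>(conj_class ` ?X)"
    using twisted_conj_class_self transporter_closed by (fastforce simp: f_def split: if_splits)
  moreover have "finite (\<Union>(conj_class ` ?X))"
    using finite_cocycle_support_classes[OF cocycle fg] FC by (auto simp: twisted_FC_def)
  ultimately have "finite {x. f x \<noteq> 0}"
    by (rule finite_subset)
  define p where "p = Abs_poly_mapping f"
  have lookup_p: "Poly_Mapping.lookup p = f"
    using \<open>finite {x. f x \<noteq> 0}\<close> by (simp add: p_def Abs_poly_mapping_inverse)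
  have p: "p \<in> carrier (group_algebra G)"
    by (auto simp: in_keys_iff lookup_p f_def split: if_splits)
  have "coefficient D g x = f x - f (act (inv g) x)"
    if g: "g \<in> carrier G" and x: "x \<in> carrier G" for g x
  proof -
    let ?y = "act (inv g) x" and ?C = "conj_class x"
    have y: "?y \<in> carrier G"
      using g x by simp
    have tc: "?t x \<in> carrier G" "?t ?y \<in> carrier G"
      using x y by (simp_all add: transporter_closed)
    have C: "?C \<in> conj_classes" "rep ?C \<in> carrier G"
      using x by (simp_all add: rep_closed)
    have z: "stabilizer_part g x \<in> stabilizer ?C" "stabilizer_part g x \<in> carrier G"
      using stabilizer_part_in[OF g x] C by (auto simp: stabilizer_iff)
    have "coefficient D g x + f ?y = coefficient D (g \<otimes> ?t ?y) x"
      using g x y tc by (simp add: mult f_def)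
    also have "g \<otimes> ?t ?y = ?t x \<otimes> stabilizer_part g x"
      using g tc by (simp add: stabilizer_part_def m_assoc[symmetric])
    also have "coefficient D \<dots> x = f x + coefficient D (stabilizer_part g x) (act (inv (?t x)) x)"
      using x z tc by (simp add: mult f_def)
    also have "act (inv (?t x)) x = rep ?C"
      using act_inv_eq_iff[of "?t x" x "rep ?C"] act_transporter[OF x] x tc C by simp
    finally show ?thesis
      using vanish[OF C(1) z(1)] by (simp add: algebra_simps)
  qed
  then have "D = inner_derivation G \<sigma> \<tau> p"
    using p
    by (intro derivation_eqI D inner_derivation_in_twisted_derivations is_monoid \<sigma>_hom \<tau>_hom)
      (simp_all add: coefficient_inner_derivation lookup_p del: group_algebra_simps(1))
  with p show ?thesis
    by blast
qed

lemma inner_derivations_eq_kernel: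
  assumes fg: "finitely_generated_group G"
  shows "inner_derivation G \<sigma> \<tau> ` carrier (group_algebra G) =
    {D \<in> carrier (derivation_space G \<sigma> \<tau>). stabilizer_restriction D = \<zero>\<^bsub>characters\<^esub>}" (is "?I = ?K")
proof (intro equalityI subsetI)
  have zero: "\<zero>\<^bsub>characters\<^esub> C z = 0" if "C \<in> conj_classes" "z \<in> stabilizer C" for C z
    using that by (simp add: module_direct_sum_def additive_characters_def)
  {
    fix D assume "D \<in> ?I"
    then obtain p where p: "p \<in> carrier (group_algebra G)" and D: "D = inner_derivation G \<sigma> \<tau> p"
      by blast
    have D': "D \<in> twisted_derivations G \<sigma> \<tau>"
      unfolding D by (rule inner_derivation_in_twisted_derivations[OF is_monoid \<sigma>_hom \<tau>_hom p])
    have "stabilizer_restriction D = \<zero>\<^bsub>characters\<^esub>"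
    proof (rule characters_eqI[OF stabilizer_restriction_in[OF fg D'] characters.zero_closed])
      fix C z assume C: "C \<in> conj_classes" and z: "z \<in> stabilizer C"
      have "coefficient D z (rep C) = 0"
        unfolding D using C z stabilizer_inv(2)[OF C z]
        by (subst coefficient_inner_derivation[OF p]) (simp_all add: stabilizer_iff rep_closed)
      then show "stabilizer_restriction D C z = \<zero>\<^bsub>characters\<^esub> C z"
        using D' C z by (simp add: zero stabilizer_restriction_apply)
    qed
    with D' show "D \<in> ?K"
      by (simp add: carrier_derivation_space)
  next
    fix D assume "D \<in> ?K"
    then have D: "D \<in> twisted_derivations G \<sigma> \<tau>" and "stabilizer_restriction D = \<zero>\<^bsub>characters\<^esub>"
      by (auto simp: carrier_derivation_space)
    then have "coefficient D z (rep C) = 0" if "C \<in> conj_classes" "z \<in> stabilizer C" for C z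
      using that stabilizer_restriction_apply[OF D that] by (simp add: zero)
    then show "D \<in> ?I"
      by (rule inner_if_coefficients_vanish_on_stabilizers[OF fg D])
  }
qed

end

end


section \<open>The decomposition\<close>

theorem theorem4:
  fixes G (structure) and \<sigma> \<tau> :: "'g \<Rightarrow> 'g" and rep :: "'g set \<Rightarrow> 'g"
  assumes "group G"
    and "finitely_generated_group G"
    and "\<sigma> \<in> hom G G"
    and "\<tau> \<in> hom G G"
    and "twisted_FC G \<sigma> \<tau>"
    and "\<And>C. C \<in> twisted_conj_classes G \<sigma> \<tau> \<Longrightarrow> rep C \<in> C"
  shows "module_isomorphic complex_field
    (derivation_space G \<sigma> \<tau>)
    (module_DirProd
      (module_direct_sum (twisted_conj_classes G \<sigma> \<tau>)
        (\<lambda>C. additive_characters (G\<lparr>carrier := twisted_centralizer G \<sigma> \<tau> (rep C)\<rparr>)))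
      (inner_derivation_space G \<sigma> \<tau>))"
proof -
  interpret group G by fact
  interpret twisted_conj_representatives G \<sigma> \<tau> rep
    using assms by unfold_locales
  show ?thesis
    unfolding inner_derivation_space_def
  proof (rule split_module_isomorphic)
    show "stabilizer_restriction \<in> linear_maps complex_field (derivation_space G \<sigma> \<tau>) characters"
      by (rule stabilizer_restriction_linear[OF assms(2)])
    show "induced_derivation \<in> linear_maps complex_field characters (derivation_space G \<sigma> \<tau>)"
      by (rule induced_derivation_linear[OF assms(5)])
    show "stabilizer_restriction (induced_derivation \<chi>) = \<chi>" if "\<chi> \<in> carrier characters" for \<chi>
      by (rule restriction_induced_derivation[OF assms(5,2) that])
    show "inner_derivation G \<sigma> \<tau> ` carrier (group_algebra G) =
        {D \<in> carrier (derivation_space G \<sigma> \<tau>). stabilizer_restriction D = \<zero>\<^bsub>characters\<^esub>}"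
      by (rule inner_derivations_eq_kernel[OF assms(5,2)])
  qed (rule derivations.module_axioms characters.module_axioms)+
qed

end
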